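(* Let $\sigma$ be an irreducible incommensurable normalized multiscale substitution scheme in $\mathbb{R}^d$. Then the dynamical system $(\mathbb{X}_\sigma^F,\mathbb{R}^d)$, where $\mathbb{R}^d$ acts on tilings by translations and $\mathbb{X}_\sigma^F$ carries the topology of the metric $D$, is minimal, i.e. every $\mathbb{R}^d$-orbit is dense in $\mathbb{X}_\sigma^F$.
   Context: Schemes. A tile in $\mathbb{R}^d$ is a bounded Lebesgue measurable set $T$ of positive measure $\mathrm{vol}\,T$ whose boundary has measure zero. A tessellation of $U\subset\mathbb{R}^d$ is a collection of tiles with pairwise disjoint interiors and union $U$; it is called a patch if $U$ is bounded ($U$ is then the support of the patch) and a tiling if $U=\mathbb{R}^d$. A multiscale substitution scheme $\sigma=(\tau_\sigma,\varrho_\sigma)$ consists of a finite list of prototiles $\tau_\sigma=(T_1,\dots,T_n)$ and, for each $i$, a tessellation $\varrho_\sigma(T_i)$ of $T_i$ all of whose tiles are translates of rescaled prototiles $\alpha T_j$, with all $\alpha\in(0,1)$. A translate of $\alpha T_j$, $\alpha>0$, is a tile of type $j$ and scale $\alpha$. Standing assumptions: $\sigma$ is normalized, i.e. $\mathrm{vol}\,T_i=1$ for all $i$; distinct prototiles are geometrically different ($T_i$ is not a rescaled copy of $T_j$ for $i\ne j$), so the type of a tile is determined by the tile. Substitution semi-flow. For $t\ge 0$, $F_t(T_i)$ is the patch supported on $e^tT_i$ obtained by starting with $e^tT_i$ and repeatedly substituting (according to the rescaled rule $\varrho_\sigma$) every tile of volume $>1$, until all tiles have volume $\le 1$. $\sigma$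 is irreducible if for all $i,j$ there is $t>0$ such that $F_t(T_i)$ contains a tile of type $j$. $\sigma$ is incommensurable if there are $i,j$ and $t_1,t_2>0$ with $t_1\notin\mathbb{Q}t_2$ such that $F_{t_1}(T_i)$ contains a tile of type $i$ and unit volume and $F_{t_2}(T_j)$ contains a tile of type $j$ and unit volume. Tiling space. Position each $T_i$ so that the origin is an interior point. Let $\mathscr{P}_\sigma=\{F_t(T_i): t\ge0,\ i=1,\dots,n\}$. Identify a patch or tiling with the closed set which is the union of the boundaries of its tiles. On closed subsets of $\mathbb{R}^d$ use the metric $D(A_1,A_2)=\inf(\{r>0: A_1\cap B(0,1/r)\subset A_2^{+r},\ A_2\cap B(0,1/r)\subset A_1^{+r}\}\cup\{1\})$, where $A^{+r}$ is the $r$-neighborhood of $A$ and $B(x,R)$ is the open Euclidean ball. The multiscale tiling space $\mathbb{X}^F_\sigma$ is the set of all tilings $\mathcal{T}$ of $\mathbb{R}^d$ such that every sub-patch of $\mathcal{T}$ is a limit, with respect to $D$, of translated sub-patches of elements of $\mathscr{P}_\sigma$.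
   Formalization: Each substitution rule is taken to be a finite tessellation, and a limit of patches means convergence in D of both the unions of boundaries and the supports; with infinite rules, or with boundaries alone, the claim is false. *)

theory Defs
  imports "HOL-Analysis.Analysis"
begin

definition tile :: "'a::euclidean_space set \<Rightarrow> bool" where
  "tile T \<longleftrightarrow> bounded T \<and> T \<in> sets lebesgue \<and> measure lebesgue T > 0
     \<and> frontier T \<in> null_sets lebesgue"

definition tessellation :: "'a::euclidean_space set set \<Rightarrow> 'a set \<Rightarrow> bool" where
  "tessellation P U \<longleftrightarrow> (\<forall>T\<in>P. tile T)
     \<and> pairwise (\<lambda>S T. disjnt (interior S) (interior T)) P \<and> \<Union>P = U"

definition patch :: "'a::euclidean_space set set \<Rightarrow> bool" where
  "patch P \<longleftrightarrow> tessellation P (\<Union>P) \<and> bounded (\<Union>P)"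

definition tiling :: "'a::euclidean_space set set \<Rightarrow> bool" where
  "tiling P \<longleftrightarrow> tessellation P UNIV"

definition sub_patch :: "'a::euclidean_space set set \<Rightarrow> 'a set set \<Rightarrow> bool" where
  "sub_patch Q P \<longleftrightarrow> Q \<subseteq> P \<and> patch Q"

definition rescaled :: "real \<Rightarrow> 'a::euclidean_space \<Rightarrow> 'a set \<Rightarrow> 'a set" where
  "rescaled \<alpha> x T = (\<lambda>y. x + \<alpha> *\<^sub>R y) ` T"

definition translate :: "'a::euclidean_space \<Rightarrow> 'a set set \<Rightarrow> 'a set set" where
  "translate x P = (\<lambda>T. (\<lambda>y. x + y) ` T) ` P"


record 'a scheme =
  prototiles :: "'a set list"
  rule :: "'a set \<Rightarrow> 'a set set"

definition tile_of_type :: "'a::euclidean_space scheme \<Rightarrow> nat \<Rightarrow> real \<Rightarrow> 'a set \<Rightarrow> bool" where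
  "tile_of_type \<sigma> j \<alpha> U \<longleftrightarrow> j < length (prototiles \<sigma>) \<and> \<alpha> > 0
     \<and> (\<exists>x. U = rescaled \<alpha> x (prototiles \<sigma> ! j))"

text \<open>
  Substitution rules are finite: \<open>T\<^sub>i\<close> is replaced by finitely many tiles. The last conjunct says
  that the prototiles are geometrically different, so that a tile, being just a set of points,
  determines its type, scale and position. Patches can therefore be sets of point sets.
\<close>

definition multiscale_scheme :: "'a::euclidean_space scheme \<Rightarrow> bool" where
  "multiscale_scheme \<sigma> \<longleftrightarrow>
     (\<forall>T \<in> set (prototiles \<sigma>). tile T \<and> tessellation (rule \<sigma> T) T \<and> finite (rule \<sigma> T)
        \<and> (\<forall>U \<in> rule \<sigma> T. \<exists>j \<alpha>. \<alpha> < 1 \<and> tile_of_type \<sigma> j \<alpha> U))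
     \<and> (\<forall>i < length (prototiles \<sigma>). \<forall>j < length (prototiles \<sigma>). i \<noteq> j \<longrightarrow>
          \<not> (\<exists>\<alpha> > 0. \<exists>x. prototiles \<sigma> ! i = rescaled \<alpha> x (prototiles \<sigma> ! j)))"

definition normalized :: "'a::euclidean_space scheme \<Rightarrow> bool" where
  "normalized \<sigma> \<longleftrightarrow> (\<forall>T \<in> set (prototiles \<sigma>). measure lebesgue T = 1)"

definition positioned :: "'a::euclidean_space scheme \<Rightarrow> bool" where
  "positioned \<sigma> \<longleftrightarrow> (\<forall>T \<in> set (prototiles \<sigma>). 0 \<in> interior T)"


text \<open>
  All tiles that occur while \<open>e\<^sup>t T\<^sub>i\<close> is substituted, including those that are themselves
  substituted later; the tiles of volume at most 1 are never substituted and form the patch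
  \<open>F\<^sub>t(T\<^sub>i)\<close>.
\<close>

inductive_set flow_tiles :: "'a::euclidean_space scheme \<Rightarrow> real \<Rightarrow> nat \<Rightarrow> 'a set set"
  for \<sigma> t i where
  start: "rescaled (exp t) 0 (prototiles \<sigma> ! i) \<in> flow_tiles \<sigma> t i"
| subst: "rescaled \<alpha> x (prototiles \<sigma> ! j) \<in> flow_tiles \<sigma> t i \<Longrightarrow>
    j < length (prototiles \<sigma>) \<Longrightarrow> \<alpha> > 0 \<Longrightarrow>
    measure lebesgue (rescaled \<alpha> x (prototiles \<sigma> ! j)) > 1 \<Longrightarrow>
    V \<in> rule \<sigma> (prototiles \<sigma> ! j) \<Longrightarrow>
    rescaled \<alpha> x V \<in> flow_tiles \<sigma> t i"

definition flow :: "'a::euclidean_space scheme \<Rightarrow> real \<Rightarrow> nat \<Rightarrow> 'a set set" where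
  "flow \<sigma> t i = {U \<in> flow_tiles \<sigma> t i. measure lebesgue U \<le> 1}"

definition irreducible_scheme :: "'a::euclidean_space scheme \<Rightarrow> bool" where
  "irreducible_scheme \<sigma> \<longleftrightarrow>
     (\<forall>i < length (prototiles \<sigma>). \<forall>j < length (prototiles \<sigma>).
        \<exists>t > 0. \<exists>U \<in> flow \<sigma> t i. \<exists>\<alpha>. tile_of_type \<sigma> j \<alpha> U)"

definition incommensurable :: "'a::euclidean_space scheme \<Rightarrow> bool" where
  "incommensurable \<sigma> \<longleftrightarrow>
     (\<exists>i < length (prototiles \<sigma>). \<exists>j < length (prototiles \<sigma>). \<exists>t\<^sub>1 > 0. \<exists>t\<^sub>2 > 0.
        \<not> (\<exists>q \<in> \<rat>. t\<^sub>1 = q * t\<^sub>2) \<and>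
        (\<exists>U \<in> flow \<sigma> t\<^sub>1 i. \<exists>\<alpha>. tile_of_type \<sigma> i \<alpha> U \<and> measure lebesgue U = 1) \<and>
        (\<exists>U \<in> flow \<sigma> t\<^sub>2 j. \<exists>\<alpha>. tile_of_type \<sigma> j \<alpha> U \<and> measure lebesgue U = 1))"


definition neighborhood :: "real \<Rightarrow> 'a::euclidean_space set \<Rightarrow> 'a set" where
  "neighborhood r A = (\<Union>a\<in>A. ball a r)"

definition close_at :: "real \<Rightarrow> 'a::euclidean_space set \<Rightarrow> 'a set \<Rightarrow> bool" where
  "close_at r A B \<longleftrightarrow> A \<inter> ball 0 (1 / r) \<subseteq> neighborhood r B
     \<and> B \<inter> ball 0 (1 / r) \<subseteq> neighborhood r A"

definition set_dist :: "'a::euclidean_space set \<Rightarrow> 'a set \<Rightarrow> real" where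
  "set_dist A B = Inf ({r. r > 0 \<and> close_at r A B} \<union> {1})"

lemma close_at_mono:
  assumes "close_at r A B" "0 < r" "r \<le> s"
  shows "close_at s A B"
proof -
  have b: "ball (0::'a) (1 / s) \<subseteq> ball 0 (1 / r)"
    using assms by (intro subset_ball) (simp add: frac_le)
  have n: "neighborhood r C \<subseteq> neighborhood s C" for C :: "'a set"
    using assms unfolding neighborhood_def by fastforce
  show ?thesis
    using assms(1) b n unfolding close_at_def by blast
qed

lemma set_dist_less_iff:
  assumes "e \<le> 1"
  shows "set_dist A B < e \<longleftrightarrow> (\<exists>r>0. r < e \<and> close_at r A B)"
proof -
  have "set_dist A B < e \<longleftrightarrow> (\<exists>r\<in>{r. r > 0 \<and> close_at r A B} \<union> {1}. r < e)"
    unfolding set_dist_def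
    by (rule cInf_less_iff) (auto intro!: bdd_belowI[of _ 0])
  then show ?thesis using assms by auto
qed

lemma set_dist_nonneg: "0 \<le> set_dist A B"
  unfolding set_dist_def by (rule cInf_greatest) auto

lemma set_dist_le_1: "set_dist A B \<le> 1"
  unfolding set_dist_def by (rule cInf_lower) (auto intro!: bdd_belowI[of _ 0])

lemma set_dist_commute: "set_dist A B = set_dist B A"
  by (simp add: set_dist_def close_at_def conj_commute)

lemma inclusion_trans:
  fixes A B C :: "'a::euclidean_space set"
  assumes "A \<inter> ball 0 (1 / r) \<subseteq> neighborhood r B"
    and "B \<inter> ball 0 (1 / s) \<subseteq> neighborhood s C"
    and "0 < r" "0 < s" "r + s < 1"
  shows "A \<inter> ball 0 (1 / (r + s)) \<subseteq> neighborhood (r + s) C"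
proof
  fix x assume x: "x \<in> A \<inter> ball 0 (1 / (r + s))"
  have le: "1 / (r + s) \<le> 1 / r"
    using assms by (simp add: frac_le)
  then have "x \<in> ball 0 (1 / r)"
    using x by auto
  then obtain y where y: "y \<in> B" "dist y x < r"
    using x assms(1) unfolding neighborhood_def by auto
  have "s * (r + s) \<le> 1 * 1"
    using assms by (intro mult_mono) auto
  then have "r * (s * (r + s)) \<le> r * 1"
    using assms by (intro mult_left_mono) auto
  then have "1 / (r + s) + r \<le> 1 / s"
    using assms by (simp add: field_simps)
  moreover have "norm y \<le> norm x + dist y x"
    by norm
  ultimately have "y \<in> ball 0 (1 / s)"
    using x y by auto
  then obtain z where z: "z \<in> C" "dist z y < s"
    using y assms(2) unfolding neighborhood_def by auto
  have "dist z x < r + s"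
    using y z dist_triangle[of z x y] by linarith
  then show "x \<in> neighborhood (r + s) C"
    using z unfolding neighborhood_def by auto
qed

lemma set_dist_triangle: "set_dist A C \<le> set_dist A B + set_dist B C"
proof (rule ccontr)
  assume "\<not> ?thesis"
  then have lt: "set_dist A B + set_dist B C < set_dist A C" by simp
  define e where "e = (set_dist A C - set_dist A B - set_dist B C) / 2"
  have e: "e > 0" "set_dist A B + e + (set_dist B C + e) = set_dist A C"
    using lt by (auto simp: e_def field_simps)
  have "set_dist A B + e \<le> 1" "set_dist B C + e \<le> 1"
    using e set_dist_le_1[of A C] set_dist_nonneg[of A B] set_dist_nonneg[of B C] by linarith+
  then obtain r s where rs: "r > 0" "r < set_dist A B + e" "close_at r A B"
      "s > 0" "s < set_dist B C + e" "close_at s B C"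
    using e set_dist_less_iff by (metis less_add_same_cancel1)
  have small: "r + s < set_dist A C" using rs e by linarith
  then have "r + s < 1" using set_dist_le_1[of A C] by linarith
  then have "close_at (r + s) A C"
    using rs inclusion_trans[of A r B s C] inclusion_trans[of C s B r A]
    unfolding close_at_def by (simp add: add.commute)
  then have "set_dist A C < set_dist A C"
    using rs small set_dist_le_1[of A C] set_dist_less_iff[of "set_dist A C" A C]
    by (metis add_pos_pos)
  then show False by simp
qed

lemma set_dist_0_imp_subset:
  assumes "set_dist A B = 0" "closed B"
  shows "A \<subseteq> B"
proof
  fix x assume x: "x \<in> A"
  have "\<exists>y\<in>B. dist y x < e" if "e > 0" for e
  proof -
    define d where "d = min (min 1 e) (1 / (norm x + 1))"
    have d: "0 < d" "d \<le> 1" "d \<le> e" "d \<le> 1 / (norm x + 1)"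
      using that by (auto simp: d_def add_nonneg_pos)
    then obtain r where "r > 0" "r < d" "close_at r A B"
      using set_dist_less_iff[of d A B] assms by auto
    then have c: "close_at d A B"
      using close_at_mono by (metis less_imp_le)
    have "norm x + 1 > 0" by (simp add: add_nonneg_pos)
    then have "(norm x + 1) * d \<le> 1"
      using d by (simp add: field_simps)
    then have "norm x * d < 1" using d by (simp add: algebra_simps)
    then have "norm x < 1 / d" using d by (simp add: field_simps)
    then have "x \<in> neighborhood d B"
      using c x unfolding close_at_def by auto
    then show ?thesis
      using d unfolding neighborhood_def by force
  qed
  then have "x \<in> closure B" by (simp add: closure_approachable)
  then show "x \<in> B" using assms by simp
qed

lemma set_dist_refl: "set_dist A A = 0"
proof -
  have "close_at r A A" if "r > 0" for r
    using that unfolding close_at_def neighborhood_def by auto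
  then have "set_dist A A < e" if "0 < e" "e \<le> 1" for e
    using that set_dist_less_iff[of e A A] by (meson dense)
  then show ?thesis
    using set_dist_nonneg[of A A] set_dist_le_1[of A A] by (metis less_eq_real_def less_irrefl)
qed

lemma Metric_space_set_dist: "Metric_space {A::'a::euclidean_space set. closed A} set_dist"
proof
  show "set_dist A B = 0 \<longleftrightarrow> A = B" if "A \<in> {A. closed A}" "B \<in> {A. closed A}"
    for A B :: "'a set"
    using that set_dist_0_imp_subset set_dist_refl set_dist_commute
    by (metis mem_Collect_eq subset_antisym)
qed (rule set_dist_nonneg set_dist_commute set_dist_triangle)+


text \<open>
  The closure does nothing for locally finite collections, whose union of boundaries is already
  closed, and never changes a \<^const>\<open>set_dist\<close>.
\<close>

definition skeleton :: "'a::euclidean_space set set \<Rightarrow> 'a set" where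
  "skeleton P = closure (\<Union>T\<in>P. frontier T)"

definition support :: "'a::euclidean_space set set \<Rightarrow> 'a set" where
  "support P = closure (\<Union>P)"

text \<open>
  A tiling is determined by its skeleton in the intended situations, but a patch is not: a ring of
  squares has the same skeleton with and without the square in the middle. Therefore a limit of
  patches is understood as a limit of the skeletons and also of the supports. With skeletons alone, a
  patch of a tiling could be approximated by patches with holes, the walls between the tiles that
  were left out of the hole would be lost in the limit, and minimality would fail. For
  tilings the support carries no information.
\<close>

definition patch_limit :: "(nat \<Rightarrow> 'a::euclidean_space set set) \<Rightarrow> 'a set set \<Rightarrow> bool" where
  "patch_limit p Q \<longleftrightarrow> (\<lambda>k. set_dist (skeleton (p k)) (skeleton Q)) \<longlonglongrightarrow> 0
     \<and> (\<lambda>k. set_dist (support (p k)) (support Q)) \<longlonglongrightarrow> 0"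

definition generating_patches :: "'a::euclidean_space scheme \<Rightarrow> 'a set set set" where
  "generating_patches \<sigma> = {flow \<sigma> t i |t i. t \<ge> 0 \<and> i < length (prototiles \<sigma>)}"

definition tiling_space :: "'a::euclidean_space scheme \<Rightarrow> 'a set set set" where
  "tiling_space \<sigma> = {\<T>. tiling \<T> \<and>
     (\<forall>Q. sub_patch Q \<T> \<longrightarrow>
        (\<exists>p. patch_limit p Q \<and>
           (\<forall>k. \<exists>P \<in> generating_patches \<sigma>. \<exists>S x. sub_patch S P \<and> p k = translate x S)))}"

definition tiling_topology :: "'a::euclidean_space scheme \<Rightarrow> 'a set set topology" where
  "tiling_topology \<sigma> =
     pullback_topology (tiling_space \<sigma>) skeleton (Metric_space.mtopology {A. closed A} set_dist)"

lemma topspace_tiling_topology: "topspace (tiling_topology \<sigma>) = tiling_space \<sigma>"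
  using Metric_space.topspace_mtopology[OF Metric_space_set_dist]
  by (auto simp: tiling_topology_def topspace_pullback_topology skeleton_def)

definition minimal_action :: "'b topology \<Rightarrow> ('g \<Rightarrow> 'b \<Rightarrow> 'b) \<Rightarrow> bool" where
  "minimal_action X act \<longleftrightarrow>
     (\<forall>p \<in> topspace X. X closure_of (range (\<lambda>g. act g p)) = topspace X)"

end

theory Submission
  imports Defs
begin

text \<open>
  Let \<open>\<T>\<close> and \<open>\<T>'\<close> be tilings in the tiling space. It has to be shown that some translate of \<open>\<T>\<close> is
  close to \<open>\<T>'\<close> on a given ball around the origin.

  By definition of the tiling space, \<open>\<T>'\<close> is close on that ball to a translate \<open>P'\<close> of some
  \<open>F\<^sub>t(T\<^sub>i)\<close>, and \<open>\<T>\<close> is close on a much larger ball to a translate \<open>P\<close> of some \<open>F\<^sub>u(T\<^sub>k)\<close>, where nothing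
  is known about \<open>u\<close> and \<open>k\<close> (\<open>near_generating_patch\<close>). So it suffices to find an approximate copy of
  \<open>P'\<close> inside \<open>P\<close>, at a bounded distance from the origin. Such a copy is obtained by the semi-flow from a
  descendant of the initial tile that has type \<open>i\<close> and scale at most \<open>e\<^sup>t\<close> but close to it: the semi-flow is
  continuous from the left (\<open>leaves_moved\<close>), so this descendant grows a slightly shrunk copy of
  \<open>F\<^sub>t(T\<^sub>i)\<close>.

  Such descendants exist below every tile of large scale \<open>e\<^sup>w\<close>, whatever its type \<open>j\<close>. The scale of a
  descendant is \<open>e\<^bsup>w - l\<^esup>\<close>, where \<open>l\<close> is the length of the line of descent, that is, the sum of the
  negative logarithms of the ratios. Irreducibility and the two loops of incommensurable lengths make
  the lengths of lines of descent from \<open>j\<close> to \<open>i\<close> eventually dense in the half-line, uniformly in \<open>j\<close>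
  (\<open>path_lengths_eventually_dense\<close>, \<open>descendant_of_prescribed_scale\<close>). It remains to choose the tile of
  scale \<open>e\<^sup>w\<close> as an ancestor of the tile of \<open>P\<close> at the origin, with \<open>w\<close> large but bounded
  (\<open>splits_intermediate\<close>).

  Two geometric points need care. Tiles of a limit tiling are known only through limits of boundaries
  and supports, so local finiteness has to be proved (\<open>finite_tiles_meeting_ball\<close>). And the patches that
  converge are sub-patches of the \<open>F\<^sub>t(T\<^sub>i)\<close>; since all tiles contain balls of a fixed radius, a sub-patch
  whose support is nearly dense in a ball is the full patch there (\<open>skeleton_dense_subpatch\<close>).
\<close>

section \<open>Similarities\<close>

lemma rescaled_eq_translation: "rescaled \<alpha> x T = (+) x ` ((*\<^sub>R) \<alpha> ` T)"
  by (auto simp: rescaled_def image_image)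

lemma rescaled_rescaled:
  "rescaled \<alpha> x (rescaled \<beta> y T) = rescaled (\<alpha> * \<beta>) (x + \<alpha> *\<^sub>R y) T"
  by (simp add: rescaled_def image_image algebra_simps)

lemma rescaled_1_0 [simp]: "rescaled 1 0 T = T"
  by (simp add: rescaled_def)

lemma translate_eq_rescaled: "translate x P = rescaled 1 x ` P"
  by (simp add: translate_def rescaled_def)

lemma mem_rescaled_iff:
  assumes "\<alpha> \<noteq> 0"
  shows "z \<in> rescaled \<alpha> x T \<longleftrightarrow> (1 / \<alpha>) *\<^sub>R (z - x) \<in> T"
proof
  have "z = x + \<alpha> *\<^sub>R ((1 / \<alpha>) *\<^sub>R (z - x))" using assms by simp
  then show "z \<in> rescaled \<alpha> x T" if "(1 / \<alpha>) *\<^sub>R (z - x) \<in> T"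
    unfolding rescaled_def using that by (rule image_eqI)
next
  assume "z \<in> rescaled \<alpha> x T"
  then show "(1 / \<alpha>) *\<^sub>R (z - x) \<in> T" using assms by (auto simp: rescaled_def)
qed

lemma rescaled_mono: "S \<subseteq> T \<Longrightarrow> rescaled \<alpha> x S \<subseteq> rescaled \<alpha> x T"
  by (auto simp: rescaled_def)

lemma rescaled_Union: "\<Union>(rescaled \<alpha> x ` P) = rescaled \<alpha> x (\<Union>P)"
  by (auto simp: rescaled_def)

lemma interior_rescaled: "\<alpha> \<noteq> 0 \<Longrightarrow> interior (rescaled \<alpha> x T) = rescaled \<alpha> x (interior T)"
  by (simp add: rescaled_eq_translation interior_translation interior_injective_linear_image
      injective_scaleR)

lemma closure_rescaled: "closure (rescaled \<alpha> x T) = rescaled \<alpha> x (closure T)"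
  by (simp add: rescaled_eq_translation closure_translation closure_scaleR)

lemma frontier_rescaled:
  assumes "\<alpha> \<noteq> 0"
  shows "frontier (rescaled \<alpha> x T) = rescaled \<alpha> x (frontier T)"
  using assms unfolding frontier_def
  by (auto simp: interior_rescaled closure_rescaled mem_rescaled_iff)

lemma ball_rescaled:
  assumes "0 < \<alpha>"
  shows "rescaled \<alpha> x (ball y r) = ball (x + \<alpha> *\<^sub>R y) (\<alpha> * r)"
proof -
  have "z \<in> rescaled \<alpha> x (ball y r) \<longleftrightarrow> z \<in> ball (x + \<alpha> *\<^sub>R y) (\<alpha> * r)" for z
  proof -
    define w where "w = (1 / \<alpha>) *\<^sub>R (z - x)"
    have "x + \<alpha> *\<^sub>R y - z = \<alpha> *\<^sub>R (y - w)"
      using assms by (simp add: w_def algebra_simps)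
    then have "dist (x + \<alpha> *\<^sub>R y) z = \<alpha> * dist y w"
      using assms by (simp add: dist_norm)
    moreover have "z \<in> rescaled \<alpha> x (ball y r) \<longleftrightarrow> w \<in> ball y r"
      unfolding w_def using assms by (intro mem_rescaled_iff) simp
    ultimately show ?thesis using assms by simp
  qed
  then show ?thesis by blast
qed

lemma measure_rescaled:
  fixes T :: "'a::euclidean_space set"
  assumes "0 < \<alpha>"
  shows "measure lebesgue (rescaled \<alpha> x T) = \<alpha> ^ DIM('a) * measure lebesgue T"
  using assms measure_lebesgue_affine[of \<alpha> x T]
  by (simp add: rescaled_def add.commute)

lemma skeleton_rescaled:
  assumes "\<alpha> \<noteq> 0"
  shows "skeleton (rescaled \<alpha> x ` P) = rescaled \<alpha> x (skeleton P)"
proof -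
  have "(\<Union>T\<in>rescaled \<alpha> x ` P. frontier T) = rescaled \<alpha> x (\<Union>T\<in>P. frontier T)"
    using rescaled_Union[of \<alpha> x "frontier ` P"] assms by (simp add: frontier_rescaled)
  then show ?thesis by (simp add: skeleton_def closure_rescaled)
qed

lemma support_rescaled: "support (rescaled \<alpha> x ` P) = rescaled \<alpha> x (support P)"
  by (simp add: support_def rescaled_Union closure_rescaled)

text \<open>If the translation by \<open>v\<close> maps a bounded set to itself, so do its iterates, which move every
  point of the set out to infinity unless \<open>v = 0\<close>.\<close>

lemma rescaled_position_unique:
  fixes T :: "'a::euclidean_space set"
  assumes "rescaled \<alpha> x T = rescaled \<alpha> y T" "bounded T" "T \<noteq> {}"
  shows "x = y"
proof -
  define B where "B = rescaled \<alpha> x T"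
  have step: "b + (y - x) \<in> B" if b: "b \<in> B" for b
  proof -
    obtain u where "u \<in> T" "b = x + \<alpha> *\<^sub>R u"
      using b unfolding B_def rescaled_def by blast
    then have "b + (y - x) \<in> rescaled \<alpha> y T" by (auto simp: rescaled_def)
    then show ?thesis using assms by (simp add: B_def)
  qed
  obtain b where b: "b \<in> B" using assms by (auto simp: B_def rescaled_def)
  have iter: "b + real n *\<^sub>R (y - x) \<in> B" for n
  proof (induction n)
    case (Suc n)
    have "b + real (Suc n) *\<^sub>R (y - x) = (b + real n *\<^sub>R (y - x)) + (y - x)"
      by (simp add: algebra_simps)
    then show ?case using step[OF Suc] by (simp only:)
  qed (use b in simp)
  have "bounded B"
    using assms unfolding B_def rescaled_eq_translation
    by (intro bounded_translation bounded_scaling)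
  then obtain K where K: "\<And>z. z \<in> B \<Longrightarrow> norm z \<le> K" by (auto simp: bounded_iff)
  show ?thesis
  proof (rule ccontr)
    assume "x \<noteq> y"
    then have pos: "0 < norm (y - x)" by simp
    obtain n :: nat where n: "K + norm b < real n * norm (y - x)"
      using reals_Archimedean3[OF pos] by blast
    have "norm (real n *\<^sub>R (y - x)) \<le> norm (b + real n *\<^sub>R (y - x)) + norm b"
      using norm_triangle_ineq4[of "b + real n *\<^sub>R (y - x)" b] by simp
    then show False using K[OF iter[of n]] n by simp
  qed
qed

section \<open>Sets that are close on a ball\<close>

text \<open>The condition \<^const>\<open>close_at\<close> ties the radius of the observed ball to the precision. Separating
  the two makes it possible to shift and to compose approximations without losing track of the
  region on which they hold.\<close>

definition near :: "real \<Rightarrow> real \<Rightarrow> 'a::euclidean_space set \<Rightarrow> 'a set \<Rightarrow> bool" where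
  "near R e A B \<longleftrightarrow> A \<inter> ball 0 R \<subseteq> neighborhood e B \<and> B \<inter> ball 0 R \<subseteq> neighborhood e A"

lemma mem_neighborhood: "x \<in> neighborhood e A \<longleftrightarrow> (\<exists>a\<in>A. dist a x < e)"
  by (auto simp: neighborhood_def)

lemma close_at_eq_near: "close_at e A B \<longleftrightarrow> near (1 / e) e A B"
  by (simp add: close_at_def near_def)

lemma near_sym: "near R e A B \<Longrightarrow> near R e B A"
  by (auto simp: near_def)

lemma near_mono:
  assumes "near R e A B" "R' \<le> R" "e \<le> e'"
  shows "near R' e' A B"
proof -
  have "neighborhood e C \<subseteq> neighborhood e' C" for C :: "'a set"
    using assms(3) unfolding mem_neighborhood subset_iff by (meson order_less_le_trans)
  moreover have "ball (0::'a) R' \<subseteq> ball 0 R" using assms(2) by auto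
  ultimately show ?thesis using assms(1) unfolding near_def by blast
qed

lemma near_trans:
  assumes "near (R + e2) e1 A B" "near (R + e1) e2 B C" "0 \<le> e1" "0 \<le> e2"
  shows "near R (e1 + e2) A C"
proof -
  have half: "A \<inter> ball 0 R \<subseteq> neighborhood (e1 + e2) C"
    if n: "near (R + e2) e1 A B" "near (R + e1) e2 B C" "0 \<le> e1" "0 \<le> e2" for A B C :: "'a set" and e1 e2
  proof
    fix x assume x: "x \<in> A \<inter> ball 0 R"
    then have "x \<in> ball 0 (R + e2)" using n by auto
    then obtain y where y: "y \<in> B" "dist y x < e1"
      using x n(1) unfolding near_def subset_iff mem_neighborhood by blast
    have "norm y \<le> norm x + dist y x" by norm
    then have "y \<in> ball 0 (R + e1)" using x y by auto
    then obtain z where "z \<in> C" "dist z y < e2"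
      using y n(2) unfolding near_def subset_iff mem_neighborhood by blast
    moreover have "dist z x \<le> dist z y + dist y x" by (rule dist_triangle)
    ultimately show "x \<in> neighborhood (e1 + e2) C"
      using y by (auto simp: mem_neighborhood intro!: bexI[of _ z])
  qed
  have "C \<inter> ball 0 R \<subseteq> neighborhood (e2 + e1) A"
    by (rule half[of e1 e2 C B A]) (use assms near_sym in auto)
  then show ?thesis
    using half[OF assms] by (auto simp: near_def add.commute)
qed

lemma near_translate:
  assumes "near R e A B" "R' + norm v \<le> R"
  shows "near R' e (rescaled 1 v A) (rescaled 1 v B)"
proof -
  have half: "rescaled 1 v A \<inter> ball 0 R' \<subseteq> neighborhood e (rescaled 1 v B)"
    if n: "near R e A B" for A B :: "'a set"
  proof
    fix x assume x: "x \<in> rescaled 1 v A \<inter> ball 0 R'"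
    then obtain u where u: "u \<in> A" "x = v + u" by (auto simp: rescaled_def)
    have "norm u \<le> norm x + norm v" using norm_triangle_ineq4[of x v] u by simp
    then have "u \<in> ball 0 R" using x assms(2) by auto
    then obtain w where "w \<in> B" "dist w u < e"
      using u n unfolding near_def subset_iff mem_neighborhood by blast
    then show "x \<in> neighborhood e (rescaled 1 v B)"
      using u by (auto simp: mem_neighborhood rescaled_def)
  qed
  show ?thesis
    using half[OF assms(1)] half[OF near_sym[OF assms(1)]] by (simp add: near_def)
qed

lemma set_dist_tendsto_0_iff:
  "(\<lambda>k. set_dist (A k) B) \<longlonglongrightarrow> 0 \<longleftrightarrow>
     (\<forall>e. 0 < e \<longrightarrow> e \<le> 1 \<longrightarrow> (\<forall>\<^sub>F k in sequentially. close_at e (A k) B))"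
proof (intro iffI allI impI)
  fix e :: real
  assume lim: "(\<lambda>k. set_dist (A k) B) \<longlonglongrightarrow> 0" and e: "0 < e" "e \<le> 1"
  have "\<forall>\<^sub>F k in sequentially. set_dist (A k) B < e"
    by (rule order_tendstoD(2)[OF lim]) (use e in simp)
  then show "\<forall>\<^sub>F k in sequentially. close_at e (A k) B"
    by eventually_elim (metis set_dist_less_iff[OF e(2)] close_at_mono less_imp_le)
next
  assume close: "\<forall>e. 0 < e \<longrightarrow> e \<le> 1 \<longrightarrow> (\<forall>\<^sub>F k in sequentially. close_at e (A k) B)"
  show "(\<lambda>k. set_dist (A k) B) \<longlonglongrightarrow> 0"
  proof (rule order_tendstoI)
    fix a :: real assume "a < 0"
    then show "\<forall>\<^sub>F k in sequentially. a < set_dist (A k) B"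
      by (intro always_eventually allI order_less_le_trans[OF _ set_dist_nonneg])
  next
    fix a :: real assume a: "0 < a"
    define e where "e = min 1 a"
    have e: "0 < e / 2" "e / 2 < e" "e / 2 \<le> 1" "e \<le> 1" "e \<le> a"
      using a by (auto simp: e_def)
    have "\<forall>\<^sub>F k in sequentially. close_at (e / 2) (A k) B" using close e by blast
    then show "\<forall>\<^sub>F k in sequentially. set_dist (A k) B < a"
    proof eventually_elim
      case (elim k)
      then have "set_dist (A k) B < e" using e set_dist_less_iff[OF e(4)] by blast
      then show ?case using e by simp
    qed
  qed
qed

text \<open>The distance is not translation invariant, since it looks at balls around the origin. Convergence
  is, because a translate of the ball of radius \<open>1 / e\<close> lies in a larger ball around the origin.\<close>

lemma set_dist_tendsto_0_translate:
  fixes A :: "nat \<Rightarrow> 'a::euclidean_space set"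
  assumes "(\<lambda>k. set_dist (A k) B) \<longlonglongrightarrow> 0"
  shows "(\<lambda>k. set_dist (rescaled 1 v (A k)) (rescaled 1 v B)) \<longlonglongrightarrow> 0"
  unfolding set_dist_tendsto_0_iff
proof (intro allI impI)
  fix e :: real assume e: "0 < e" "e \<le> 1"
  define d where "d = 1 / (1 / e + norm v)"
  have d: "0 < d" "1 / d = 1 / e + norm v" using e by (auto simp: d_def add_pos_nonneg)
  have "d \<le> 1 / (1 / e)"
    unfolding d_def using e by (intro divide_left_mono) (auto simp: add_pos_nonneg)
  then have "d \<le> e" by simp
  then have "\<forall>\<^sub>F k in sequentially. close_at d (A k) B"
    using assms d e unfolding set_dist_tendsto_0_iff by auto
  then show "\<forall>\<^sub>F k in sequentially. close_at e (rescaled 1 v (A k)) (rescaled 1 v B)"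
  proof eventually_elim
    case (elim k)
    then have "near (1 / d) e (A k) B"
      using \<open>d \<le> e\<close> by (auto simp: close_at_eq_near intro: near_mono)
    then show ?case
      unfolding close_at_eq_near by (rule near_translate) (use d in simp)
  qed
qed

section \<open>The tiling space is translation invariant\<close>

lemma tile_translate:
  assumes "tile T" shows "tile (rescaled 1 v T)"
proof -
  have eq: "rescaled 1 v S = (+) v ` S" for S :: "'a set" by (simp add: rescaled_def)
  have "frontier T \<in> null_sets lebesgue" using assms by (simp add: tile_def)
  then have "negligible ((+) v ` frontier T)"
    by (intro negligible_translation) (simp add: negligible_iff_null_sets)
  then show ?thesis
    using assms measure_rescaled[of 1 v T]
    by (auto simp: tile_def eq frontier_translation bounded_translation lebesgue_sets_translation
        negligible_iff_null_sets)
qed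

lemma tessellation_translate:
  assumes "tessellation P U" shows "tessellation (translate v P) (rescaled 1 v U)"
proof -
  have "disjnt (interior (rescaled 1 v S)) (interior (rescaled 1 v T))"
    if "S \<in> P" "T \<in> P" "rescaled 1 v S \<noteq> rescaled 1 v T" for S T
  proof -
    have "disjnt (interior S) (interior T)"
      using that assms by (metis pairwiseD tessellation_def)
    moreover have "interior (rescaled 1 v X) = rescaled 1 v (interior X)" for X :: "'a set"
      by (simp add: interior_rescaled)
    ultimately show ?thesis
      unfolding disjnt_def by (auto simp: mem_rescaled_iff)
  qed
  then show ?thesis
    using assms by (auto simp: tessellation_def translate_eq_rescaled tile_translate
        rescaled_Union pairwise_def)
qed

lemma translate_translate: "translate x (translate y P) = translate (x + y) P"
  by (simp add: translate_eq_rescaled image_image rescaled_rescaled)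

lemma translate_0 [simp]: "translate 0 P = P"
  by (simp add: translate_eq_rescaled)

lemma sub_patch_translate:
  assumes "sub_patch Q P" shows "sub_patch (translate v Q) (translate v P)"
proof -
  have "\<Union>(translate v Q) = rescaled 1 v (\<Union>Q)"
    by (simp add: translate_eq_rescaled rescaled_Union)
  moreover have "bounded (rescaled 1 v (\<Union>Q))"
    using assms bounded_translation[of "\<Union>Q" v]
    by (simp add: sub_patch_def patch_def rescaled_def del: bounded_Union)
  ultimately have "patch (translate v Q)"
    using assms tessellation_translate[of Q "\<Union>Q" v]
    by (simp add: sub_patch_def patch_def)
  then show ?thesis
    using assms by (auto simp: sub_patch_def translate_def)
qed

lemma patch_limit_translate:
  assumes "patch_limit p Q" shows "patch_limit (\<lambda>k. translate v (p k)) (translate v Q)"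
  using assms
  by (simp add: patch_limit_def translate_eq_rescaled skeleton_rescaled support_rescaled
      set_dist_tendsto_0_translate)

lemma translate_in_tiling_space:
  assumes "\<T> \<in> tiling_space \<sigma>" shows "translate v \<T> \<in> tiling_space \<sigma>"
proof -
  have til: "tiling \<T>" using assms by (simp add: tiling_space_def)
  have "rescaled 1 v (UNIV :: 'a set) = UNIV"
    by (auto simp: mem_rescaled_iff)
  then have "tiling (translate v \<T>)"
    using tessellation_translate[of \<T> UNIV v] til by (simp add: tiling_def)
  moreover have "\<exists>p. patch_limit p Q \<and>
      (\<forall>k. \<exists>P\<in>generating_patches \<sigma>. \<exists>S x. sub_patch S P \<and> p k = translate x S)"
    if "sub_patch Q (translate v \<T>)" for Q
  proof -
    have "sub_patch (translate (- v) Q) \<T>"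
      using sub_patch_translate[OF that, of "- v"] by (simp add: translate_translate)
    then obtain p where p: "patch_limit p (translate (- v) Q)"
        "\<And>k. \<exists>P\<in>generating_patches \<sigma>. \<exists>S x. sub_patch S P \<and> p k = translate x S"
      using assms unfolding tiling_space_def by blast
    have "patch_limit (\<lambda>k. translate v (p k)) Q"
      using patch_limit_translate[OF p(1), of v] by (simp add: translate_translate)
    moreover have "\<exists>P\<in>generating_patches \<sigma>. \<exists>S x. sub_patch S P \<and> translate v (p k) = translate x S"
      for k using p(2)[of k] by (metis translate_translate)
    ultimately show ?thesis by (intro exI[of _ "\<lambda>k. translate v (p k)"]) blast
  qed
  ultimately show ?thesis by (simp add: tiling_space_def)
qed

section \<open>Fat patches\<close>

text \<open>The geometry shared by all generated patches, with uniform constants. The condition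
  \<open>V \<subseteq> closure (interior V)\<close> keeps the frontier of one tile out of the interior of another, which
  disjointness of the interiors alone does not.\<close>

definition fat_patch :: "real \<Rightarrow> real \<Rightarrow> 'a::euclidean_space set set \<Rightarrow> bool" where
  "fat_patch r D P \<longleftrightarrow>
     (\<forall>V\<in>P. V \<subseteq> closure (interior V) \<and> (\<exists>x. ball x r \<subseteq> V \<and> V \<subseteq> ball x D))
     \<and> pairwise (\<lambda>S T. disjnt (interior S) (interior T)) P"

lemma fat_patch_subset: "fat_patch r D P \<Longrightarrow> S \<subseteq> P \<Longrightarrow> fat_patch r D S"
  by (auto simp: fat_patch_def intro: pairwise_subset)

lemma fat_patch_eqI:
  assumes "fat_patch r D P" "V \<in> P" "W \<in> P" "w \<in> W" "w \<in> interior V"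
  shows "V = W"
proof -
  have "w \<in> closure (interior W)" using assms by (auto simp: fat_patch_def)
  then have "interior V \<inter> interior W \<noteq> {}"
    using open_Int_closure_eq_empty[of "interior V" "interior W"] assms by auto
  then show ?thesis
    using assms unfolding fat_patch_def pairwise_def disjnt_def by blast
qed

lemma interior_Int_skeleton:
  assumes "fat_patch r D P" "V \<in> P"
  shows "interior V \<inter> skeleton P = {}"
proof -
  have "interior V \<inter> frontier W = {}" if W: "W \<in> P" for W
  proof (cases "W = V")
    case True
    then show ?thesis by (auto simp: frontier_def)
  next
    case False
    then have "interior V \<inter> interior W = {}"
      using assms W unfolding fat_patch_def pairwise_def disjnt_def by blast
    then have "interior V \<inter> closure (interior W) = {}"
      by (simp add: open_Int_closure_eq_empty)
    moreover have "closure W \<subseteq> closure (interior W)"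
      using assms W by (simp add: fat_patch_def closure_minimal)
    ultimately show ?thesis by (auto simp: frontier_def)
  qed
  then have "interior V \<inter> (\<Union>W\<in>P. frontier W) = {}" by blast
  then show ?thesis
    by (simp add: skeleton_def open_Int_closure_eq_empty)
qed

text \<open>This lemma turns closeness of supports into equality of patches. A tile of \<open>P\<close> with a wall in the
  ball contains a ball of radius \<open>r\<close>, which the dense set \<open>\<Union>S\<close> must enter; so this tile overlaps a tile
  of \<open>S\<close> and is therefore equal to it.\<close>

lemma skeleton_dense_subpatch:
  assumes fat: "fat_patch r D P" and "S \<subseteq> P"
    and dense: "ball 0 (R + D) \<subseteq> neighborhood r (\<Union>S)"
  shows "skeleton P \<inter> ball 0 R \<subseteq> skeleton S"
proof -
  have "ball 0 R \<inter> (\<Union>V\<in>P. frontier V) \<subseteq> (\<Union>V\<in>S. frontier V)"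
  proof
    fix y assume "y \<in> ball 0 R \<inter> (\<Union>V\<in>P. frontier V)"
    then obtain V where V: "V \<in> P" "y \<in> frontier V" "norm y < R" by auto
    obtain x where x: "ball x r \<subseteq> V" "V \<subseteq> ball x D"
      using fat V by (auto simp: fat_patch_def)
    have "closure V \<subseteq> cball x D"
      using x(2) by (intro closure_minimal) (auto intro: order.trans[OF _ ball_subset_cball])
    then have "dist x y \<le> D" using V by (auto simp: frontier_def)
    moreover have "norm x \<le> norm y + dist x y" by norm
    ultimately have "x \<in> ball 0 (R + D)" using V by simp
    then obtain W w where w: "W \<in> S" "w \<in> W" "dist w x < r"
      using dense unfolding subset_iff mem_neighborhood by blast
    have "w \<in> interior V"
      using interior_maximal[OF x(1)] w by (auto simp: dist_commute)
    then have "V = W" using fat_patch_eqI[OF fat] V w assms(2) by blast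
    then show "y \<in> (\<Union>V\<in>S. frontier V)" using V w by blast
  qed
  then have "closure (ball 0 R \<inter> (\<Union>V\<in>P. frontier V)) \<subseteq> skeleton S"
    unfolding skeleton_def by (rule closure_mono)
  then show ?thesis
    unfolding skeleton_def
    using open_Int_closure_subset[of "ball 0 R" "\<Union>V\<in>P. frontier V"] by auto
qed

lemma skeleton_mono: "S \<subseteq> P \<Longrightarrow> skeleton S \<subseteq> skeleton P"
  unfolding skeleton_def by (intro closure_mono) auto

text \<open>The form in which membership in the tiling space is used: a limit of patches, read at one scale
  of precision.\<close>

definition locally_from :: "'a::euclidean_space set set set \<Rightarrow> 'a set set \<Rightarrow> bool" where
  "locally_from \<G> \<T> \<longleftrightarrow> (\<forall>Q e. sub_patch Q \<T> \<longrightarrow> 0 < e \<longrightarrow> e \<le> 1 \<longrightarrow>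
     (\<exists>P\<in>\<G>. \<exists>S\<subseteq>P. close_at e (skeleton S) (skeleton Q) \<and> close_at e (support S) (support Q)))"

text \<open>A tile of a limit tiling is known only through its frontier and its closure, and it need not be a
  rescaled prototile. But near each of its points there is a tile \<open>U\<close> of an approximating patch; no
  wall runs through the ball of radius \<open>r\<close> inside \<open>U\<close>, so in the limit tiling no wall runs through
  half of that ball, and the latter lies on one side of the frontier.\<close>

lemma tile_contains_ball:
  assumes fat: "\<And>P. P \<in> \<G> \<Longrightarrow> fat_patch r D P" and "0 < r" "0 < D"
    and til: "tiling \<T>" and loc: "locally_from \<G> \<T>" and "A \<in> \<T>" "z \<in> A"
  shows "\<exists>x. ball x (r / 2) \<subseteq> A \<and> dist x z < D + 1"
proof -
  define K where "K = norm z + D + r + 2"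
  define e where "e = min (1 / 2) (min (r / 4) (1 / K))"
  have "0 < K" using assms by (auto simp: K_def intro: add_nonneg_pos)
  then have e: "0 < e" "e \<le> 1" "e \<le> 1 / 2" "e \<le> r / 4" "e \<le> 1 / K"
    using assms by (auto simp: e_def)
  then have Ke: "K \<le> 1 / e" using \<open>0 < K\<close> by (simp add: field_simps)
  have "sub_patch {A} \<T>"
    using til \<open>A \<in> \<T>\<close> by (auto simp: tiling_def tessellation_def sub_patch_def patch_def tile_def)
  then obtain P S where P: "P \<in> \<G>" "S \<subseteq> P" "close_at e (skeleton S) (skeleton {A})"
      "close_at e (support S) (support {A})"
    using loc e unfolding locally_from_def by meson
  have fatS: "fat_patch r D S" using fat P fat_patch_subset by blast
  have skel: "near K e (skeleton S) (frontier A)" and supp: "near K e (support S) (closure A)"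
    using P near_mono[OF _ Ke order_refl]
    by (auto simp: close_at_eq_near skeleton_def support_def)
  have "z \<in> closure A" "z \<in> ball 0 K"
    using assms closure_subset by (auto simp: K_def)
  then obtain z1 where z1: "z1 \<in> closure (\<Union>S)" "dist z1 z < e"
    using supp unfolding near_def subset_iff mem_neighborhood support_def by blast
  then obtain z2 where z2: "z2 \<in> \<Union>S" "dist z2 z1 < e"
    using e unfolding closure_approachable by blast
  then obtain U where U: "U \<in> S" "z2 \<in> U" by blast
  obtain x where x: "ball x r \<subseteq> U" "U \<subseteq> ball x D"
    using fatS U by (auto simp: fat_patch_def)
  have "dist x z2 < D" using x U by auto
  then have xz: "dist x z < D + 1"
    using z1 z2 e dist_triangle[of x z z2] dist_triangle[of z2 z z1] by linarith
  have "norm x \<le> norm z + dist x z" by norm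
  then have "x \<in> ball 0 K" using \<open>0 < r\<close> xz by (simp add: K_def)
  moreover have "x \<in> support S"
  proof -
    have "x \<in> U" using x(1) \<open>0 < r\<close> by auto
    then show ?thesis using U closure_subset[of "\<Union>S"] unfolding support_def by blast
  qed
  ultimately obtain y where y: "y \<in> closure A" "dist y x < e"
    using supp unfolding near_def subset_iff mem_neighborhood by blast
  have "ball x (r / 2) \<inter> frontier A = {}"
  proof (rule ccontr)
    assume "ball x (r / 2) \<inter> frontier A \<noteq> {}"
    then obtain f where f: "dist x f < r / 2" "f \<in> frontier A" by auto
    have "norm f \<le> norm z + dist x z + dist x f" by norm
    then have "f \<in> ball 0 K" using f xz \<open>0 < r\<close> by (simp add: K_def)
    then obtain g where g: "g \<in> skeleton S" "dist g f < e"
      using skel f unfolding near_def subset_iff mem_neighborhood by blast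
    have "dist x g < r"
      using f g e dist_triangle[of x g f] by (simp add: dist_commute)
    then have "g \<in> interior U" using interior_maximal[OF x(1)] by auto
    then show False using interior_Int_skeleton[OF fatS U(1)] g by blast
  qed
  moreover have "ball x (r / 2) \<inter> A \<noteq> {}"
  proof -
    have "y \<in> ball x (r / 2)" using y e \<open>0 < r\<close> by (simp add: dist_commute)
    then have "ball x (r / 2) \<inter> closure A \<noteq> {}" using y by blast
    then show ?thesis by (simp add: open_Int_closure_eq_empty)
  qed
  ultimately have "ball x (r / 2) \<subseteq> A"
    using connected_Int_frontier[of "ball x (r / 2)" A] by auto
  then show ?thesis using xz by blast
qed

text \<open>Local finiteness: the balls just found inside distinct tiles are disjoint, hence have separated
  centres in a bounded region. It makes the tiles that meet a ball a patch, although the diameters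
  of the tiles are not known to be bounded.\<close>

lemma finite_tiles_meeting_ball:
  assumes fat: "\<And>P. P \<in> \<G> \<Longrightarrow> fat_patch r D P" and r: "0 < r" "0 < D"
    and til: "tiling \<T>" and loc: "locally_from \<G> \<T>"
  shows "finite {A \<in> \<T>. A \<inter> ball 0 R \<noteq> {}}" (is "finite ?F")
proof -
  have "\<forall>A\<in>?F. \<exists>x. ball x (r / 2) \<subseteq> A \<and> norm x \<le> R + D + 1"
  proof
    fix A assume "A \<in> ?F"
    obtain z where z: "z \<in> A" "norm z < R" using \<open>A \<in> ?F\<close> by auto
    obtain x where "ball x (r / 2) \<subseteq> A" "dist x z < D + 1"
      using tile_contains_ball[OF fat r til loc _ z(1)] \<open>A \<in> ?F\<close> by blast
    moreover have "norm x \<le> norm z + dist x z" by norm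
    ultimately show "\<exists>x. ball x (r / 2) \<subseteq> A \<and> norm x \<le> R + D + 1"
      using z by (intro exI[of _ x]) auto
  qed
  from bchoice[OF this]
  obtain c where "\<forall>A\<in>?F. ball (c A) (r / 2) \<subseteq> A \<and> norm (c A) \<le> R + D + 1" by blast
  then have c: "\<And>A. A \<in> ?F \<Longrightarrow> ball (c A) (r / 2) \<subseteq> A"
      "\<And>A. A \<in> ?F \<Longrightarrow> norm (c A) \<le> R + D + 1"
    by blast+
  have sep: "A = B" if "A \<in> ?F" "B \<in> ?F" "dist (c A) (c B) < r / 2" for A B
  proof (rule ccontr)
    assume "A \<noteq> B"
    then have "disjnt (interior A) (interior B)"
      using til that unfolding tiling_def tessellation_def pairwise_def by blast
    moreover have "c B \<in> interior A" "c B \<in> interior B"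
      using interior_maximal[OF c(1)] that r by (auto simp: subset_iff)
    ultimately show False by (auto simp: disjnt_def)
  qed
  have "uniform_discrete (c ` ?F)"
  proof (rule uniformI1)
    fix x y assume "x \<in> c ` ?F" "y \<in> c ` ?F" and lt: "dist x y < r / 2"
    then obtain A B where AB: "A \<in> ?F" "B \<in> ?F" "x = c A" "y = c B" by blast
    then show "x = y" using sep[OF AB(1,2)] lt by simp
  qed (use r in simp)
  moreover have "bounded (c ` ?F)"
    unfolding bounded_iff using c(2) by blast
  ultimately have "finite (c ` ?F)"
    using discrete_compact_finite_iff uniform_discrete_imp_closed uniform_discrete_imp_discrete
      compact_eq_bounded_closed by blast
  moreover have "inj_on c ?F"
    by (rule inj_onI, rule sep) (use r in simp_all)
  ultimately show ?thesis by (rule finite_imageD)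
qed

text \<open>Approximating the patch of all tiles of \<open>\<T>\<close> that meet a slightly larger ball gives a sub-patch \<open>S\<close>
  of some \<open>P\<close>. Since the support of \<open>S\<close> is dense there, the tiles of \<open>P\<close> outside \<open>S\<close> stay away from
  the ball. Thus one may compare \<open>\<T>\<close> with the whole of \<open>P\<close> instead of a part of it.\<close>

lemma near_generating_patch:
  assumes fat: "\<And>P. P \<in> \<G> \<Longrightarrow> fat_patch r D P" and r: "0 < r" "0 < D"
    and til: "tiling \<T>" and loc: "locally_from \<G> \<T>" and "0 < R" "0 < e"
  shows "\<exists>P\<in>\<G>. near R e (skeleton \<T>) (skeleton P) \<and> ball 0 R \<subseteq> neighborhood e (\<Union>P)"
proof -
  define K where "K = R + D + 1"
  define d where "d = min (min 1 (1 / K)) (min (e / 2) (r / 2))"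
  have "0 < K" using assms by (simp add: K_def)
  then have d: "0 < d" "d \<le> 1" "d \<le> 1 / K" "d \<le> e / 2" "d \<le> r / 2"
    using assms by (auto simp: d_def)
  then have Kd: "K \<le> 1 / d" using \<open>0 < K\<close> by (simp add: field_simps)
  define Q where "Q = {A \<in> \<T>. A \<inter> ball 0 K \<noteq> {}}"
  have "finite Q" unfolding Q_def by (rule finite_tiles_meeting_ball[OF fat r til loc])
  then have "sub_patch Q \<T>"
    using til by (auto simp: tiling_def tessellation_def sub_patch_def patch_def tile_def Q_def
        intro: pairwise_subset)
  then obtain P S where P: "P \<in> \<G>" "S \<subseteq> P" "close_at d (skeleton S) (skeleton Q)"
      "close_at d (support S) (support Q)"
    using loc d unfolding locally_from_def by meson
  have skel: "near K d (skeleton S) (skeleton Q)" and supp: "near K d (support S) (support Q)"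
    using P near_mono[OF _ Kd order_refl] by (auto simp: close_at_eq_near)
  have Qskel: "skeleton \<T> \<inter> ball 0 K \<subseteq> skeleton Q"
  proof -
    have "A \<in> Q" if "A \<in> \<T>" "y \<in> frontier A" "y \<in> ball 0 K" for A y
    proof -
      have "y \<in> closure A" using that by (simp add: frontier_def)
      then have "ball 0 K \<inter> A \<noteq> {}"
        using open_Int_closure_eq_empty[of "ball 0 K" A] that by auto
      then show ?thesis using that by (auto simp: Q_def)
    qed
    then have "ball 0 K \<inter> (\<Union>A\<in>\<T>. frontier A) \<subseteq> (\<Union>A\<in>Q. frontier A)" by blast
    then have "closure (ball 0 K \<inter> (\<Union>A\<in>\<T>. frontier A)) \<subseteq> skeleton Q"
      unfolding skeleton_def by (rule closure_mono)
    then show ?thesis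
      unfolding skeleton_def
      using open_Int_closure_subset[of "ball 0 K" "\<Union>A\<in>\<T>. frontier A"] by auto
  qed
  have Qsupp: "ball 0 K \<subseteq> support Q"
  proof
    fix y :: 'a assume y: "y \<in> ball 0 K"
    obtain A where "A \<in> \<T>" "y \<in> A"
      using til unfolding tiling_def tessellation_def by blast
    then have "y \<in> \<Union>Q" using y unfolding Q_def by blast
    then show "y \<in> support Q" unfolding support_def by (rule subsetD[OF closure_subset])
  qed
  have dense: "ball 0 K \<subseteq> neighborhood (2 * d) (\<Union>S)"
  proof
    fix y :: 'a assume "y \<in> ball 0 K"
    then obtain w where w: "w \<in> support S" "dist w y < d"
      using supp Qsupp unfolding near_def subset_iff mem_neighborhood by blast
    then obtain u where u: "u \<in> \<Union>S" "dist u w < d"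
      using d unfolding support_def closure_approachable by blast
    have "dist u y < 2 * d" using w u dist_triangle[of u y w] by simp
    then show "y \<in> neighborhood (2 * d) (\<Union>S)" using u unfolding mem_neighborhood by blast
  qed
  have nmono: "neighborhood (2 * d) (\<Union>S) \<subseteq> neighborhood t (\<Union>X)" if "S \<subseteq> X" "2 * d \<le> t" for t X
  proof
    fix y assume "y \<in> neighborhood (2 * d) (\<Union>S)"
    then obtain w where "w \<in> \<Union>S" "dist w y < 2 * d" unfolding mem_neighborhood by blast
    then have "w \<in> \<Union>X" "dist w y < t" using that by auto
    then show "y \<in> neighborhood t (\<Union>X)" unfolding mem_neighborhood by blast
  qed
  have "skeleton P \<inter> ball 0 R \<subseteq> skeleton S"
  proof (rule skeleton_dense_subpatch[OF fat[OF P(1)] P(2)])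
    have "ball (0::'a) (R + D) \<subseteq> ball 0 K" by (auto simp: K_def)
    then show "ball 0 (R + D) \<subseteq> neighborhood r (\<Union>S)"
      using dense nmono[of S r] d by auto
  qed
  moreover have "skeleton S \<subseteq> skeleton P" by (rule skeleton_mono) (rule P)
  moreover have "skeleton Q \<subseteq> skeleton \<T>" by (rule skeleton_mono) (auto simp: Q_def)
  moreover have "ball (0::'a) R \<subseteq> ball 0 K" using r by (auto simp: K_def)
  ultimately have "near R d (skeleton \<T>) (skeleton P)"
    using skel Qskel unfolding near_def subset_iff mem_neighborhood Int_iff by meson
  then have "near R e (skeleton \<T>) (skeleton P)"
    by (rule near_mono) (use d in auto)
  moreover have "ball 0 R \<subseteq> neighborhood e (\<Union>P)"
    using \<open>ball 0 R \<subseteq> ball 0 K\<close> dense nmono[of P e] P d by auto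
  ultimately show ?thesis using P by blast
qed

section \<open>Combinations of two incommensurable lengths\<close>

text \<open>The small number \<open>\<delta> = p * s - q * t\<close> is itself a combination, but with a negative coefficient.
  For large \<open>w\<close> one first uses many copies of \<open>t\<close>, then fills the remaining gap, shorter than \<open>t\<close>,
  with steps of size \<open>\<delta>\<close>; the copies of \<open>t\<close> pay for the negative coefficients.\<close>

lemma combinations_eventually_dense_step:
  fixes s t \<eta> :: real and p q :: nat
  assumes "0 < t" and \<delta>: "0 < p * s - q * t" "p * s - q * t < \<eta>"
  shows "\<exists>W. \<forall>w\<ge>W. \<exists>(m::nat) (n::nat). w \<le> m * s + n * t \<and> m * s + n * t < w + \<eta>"
proof -
  define \<delta> where "\<delta> = p * s - q * t"
  have "0 < \<delta>" using \<delta> by (simp add: \<delta>_def)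
  then obtain N :: nat where N: "t < N * \<delta>" using reals_Archimedean3 by blast
  have "\<exists>(m::nat) (n::nat). w \<le> m * s + n * t \<and> m * s + n * t < w + \<eta>" if w: "N * q * t \<le> w" for w
  proof -
    have "0 \<le> N * q * t" using \<open>0 < t\<close> by simp
    then have w0: "0 \<le> w" using w by simp
    define m where "m = nat \<lfloor>w / t\<rfloor>"
    have "real m = of_int \<lfloor>w / t\<rfloor>"
      using w0 \<open>0 < t\<close> by (simp add: m_def)
    then have "real m \<le> w / t" "w / t < real m + 1" by linarith+
    then have m: "m * t \<le> w" "w < m * t + t"
      using \<open>0 < t\<close> by (simp_all add: field_simps)
    have "real (N * q) \<le> w / t" using w \<open>0 < t\<close> by (simp add: field_simps)
    then have mN: "N * q \<le> m" using \<open>w / t < real m + 1\<close> by linarith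
    define k where "k = nat \<lceil>(w - m * t) / \<delta>\<rceil>"
    have "0 \<le> (w - m * t) / \<delta>" using m \<open>0 < \<delta>\<close> by simp
    then have "real k = of_int \<lceil>(w - m * t) / \<delta>\<rceil>" by (simp add: k_def)
    then have "(w - m * t) / \<delta> \<le> k" "k < (w - m * t) / \<delta> + 1" by linarith+
    then have k: "w - m * t \<le> k * \<delta>" "k * \<delta> < w - m * t + \<delta>"
      using \<open>0 < \<delta>\<close> by (simp_all add: field_simps)
    have "k * \<delta> < (N + 1) * \<delta>" using k m N by (simp add: algebra_simps)
    then have "real k < real (N + 1)" using \<open>0 < \<delta>\<close> by (simp add: mult_less_cancel_right)
    then have "k \<le> N" by linarith
    then have "k * q \<le> m" using mN by (meson le_trans mult_le_mono1)
    then have "(k * p) * s + (m - k * q) * t = m * t + k * \<delta>"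
      by (simp add: \<delta>_def of_nat_diff algebra_simps)
    then show ?thesis
      using k \<delta> unfolding \<delta>_def[symmetric] by (intro exI[of _ "k * p"] exI[of _ "m - k * q"]) simp
  qed
  then show ?thesis by blast
qed

lemma combinations_eventually_dense:
  fixes s t \<eta> :: real
  assumes "0 < s" "0 < t" "\<not> (\<exists>q\<in>\<rat>. s = q * t)" "0 < \<eta>"
  shows "\<exists>W. \<forall>w\<ge>W. \<exists>(m::nat) (n::nat). w \<le> m * s + n * t \<and> m * s + n * t < w + \<eta>"
proof -
  obtain N0 :: nat where N0: "max (t / \<eta>) (t / s) < N0" using reals_Archimedean2 by blast
  moreover have "0 < t / s" using assms by simp
  ultimately have N: "t / \<eta> < N0" "t / s < N0" "0 < real N0" by linarith+
  then have "0 < N0" by simp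
  then obtain h k :: int where hk: "0 < k" "\<bar>of_int k * (s / t) - of_int h\<bar> < 1 / N0"
    by (rule Dirichlet_approx)
  have "\<bar>of_int k * (s / t) - of_int h\<bar> * t < 1 / N0 * t"
    using hk \<open>0 < t\<close> by (intro mult_strict_right_mono)
  moreover have "\<bar>of_int k * (s / t) - of_int h\<bar> * t = \<bar>of_int k * s - of_int h * t\<bar>"
  proof -
    have "\<bar>of_int k * (s / t) - of_int h\<bar> * t = \<bar>(of_int k * (s / t) - of_int h) * t\<bar>"
      using \<open>0 < t\<close> by (simp add: abs_mult)
    then show ?thesis using \<open>0 < t\<close> by (simp add: field_simps)
  qed
  ultimately have "\<bar>of_int k * s - of_int h * t\<bar> < t / N0" by simp
  moreover have "t / N0 < \<eta>" "t / N0 < s" using N assms by (simp_all add: field_simps)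
  ultimately have close: "\<bar>of_int k * s - of_int h * t\<bar> < \<eta>" "\<bar>of_int k * s - of_int h * t\<bar> < s"
    by simp_all
  have "1 * s \<le> of_int k * s" using hk assms by (intro mult_right_mono) simp_all
  then have "0 < of_int h * t" using close by linarith
  then have "0 < h" using \<open>0 < t\<close> by (simp add: zero_less_mult_iff)
  have "of_int k * s \<noteq> of_int h * t"
  proof
    assume "of_int k * s = of_int h * t"
    then have "s = (of_int h / of_int k) * t" using hk by (simp add: field_simps)
    then show False using assms(3) Rats_divide Rats_of_int by blast
  qed
  then consider "0 < of_int k * s - of_int h * t" | "0 < of_int h * t - of_int k * s" by linarith
  then show ?thesis
  proof cases
    case 1
    then show ?thesis
      using combinations_eventually_dense_step[of t "nat k" s "nat h" \<eta>] hk \<open>0 < h\<close> close assms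
      by simp
  next
    case 2
    then have "\<exists>W. \<forall>w\<ge>W. \<exists>(m::nat) (n::nat). w \<le> m * t + n * s \<and> m * t + n * s < w + \<eta>"
      using combinations_eventually_dense_step[of s "nat h" t "nat k" \<eta>] hk \<open>0 < h\<close> close assms
      by simp
    then show ?thesis by (metis add.commute)
  qed
qed

section \<open>The tree of substituted tiles\<close>

text \<open>A tile together with its scale, position and type. All scales refer to prototiles of volume 1, so a
  tile has volume greater than 1 exactly if its scale is greater than 1. Substitution acts on nodes
  by similarities, and for a scheme with geometrically different prototiles a node is determined by
  its tile.\<close>

datatype 'a node = Node (scale: real) (pos: 'a) (kind: nat)

definition moved :: "real \<Rightarrow> 'a::euclidean_space \<Rightarrow> 'a node \<Rightarrow> 'a node" where
  "moved s v p = Node (s * scale p) (v + s *\<^sub>R pos p) (kind p)"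

lemma moved_sel [simp]:
  "scale (moved s v p) = s * scale p" "pos (moved s v p) = v + s *\<^sub>R pos p"
  "kind (moved s v p) = kind p"
  by (simp_all add: moved_def)

lemma moved_moved: "moved s v (moved s' v' p) = moved (s * s') (v + s *\<^sub>R v') p"
  by (simp add: moved_def algebra_simps)

text \<open>A scheme has finitely many substitution rules, so all ratios of consecutive scales lie in some
  interval \<open>{c..a}\<close> with \<open>0 < c\<close> and \<open>a < 1\<close>, and all prototiles lie between two balls. These bounds
  are what makes the patches uniformly fat.\<close>

locale bounded_scheme =
  fixes \<sigma> :: "'a::euclidean_space scheme" and a c r D :: real
  assumes scheme: "multiscale_scheme \<sigma>" and normalized: "normalized \<sigma>"
    and bounds: "0 < c" "c \<le> a" "a < 1" "0 < r" "0 < D"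
    and inner: "j < length (prototiles \<sigma>) \<Longrightarrow> ball 0 r \<subseteq> prototiles \<sigma> ! j"
    and outer: "j < length (prototiles \<sigma>) \<Longrightarrow> prototiles \<sigma> ! j \<subseteq> ball 0 D"
    and ratio: "\<lbrakk>j < length (prototiles \<sigma>); k < length (prototiles \<sigma>); 0 < \<beta>;
      rescaled \<beta> y (prototiles \<sigma> ! k) \<in> rule \<sigma> (prototiles \<sigma> ! j)\<rbrakk> \<Longrightarrow> c \<le> \<beta> \<and> \<beta> \<le> a"
begin

abbreviation proto :: "nat \<Rightarrow> 'a set" where "proto j \<equiv> prototiles \<sigma> ! j"

definition tile_at :: "'a node \<Rightarrow> 'a set" where
  "tile_at p = rescaled (scale p) (pos p) (proto (kind p))"

definition valid :: "'a node \<Rightarrow> bool" where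
  "valid p \<longleftrightarrow> 0 < scale p \<and> kind p < length (prototiles \<sigma>)"

definition child :: "'a node \<Rightarrow> 'a node \<Rightarrow> bool" where
  "child p q \<longleftrightarrow> (\<exists>\<beta> y k. 0 < \<beta> \<and> k < length (prototiles \<sigma>)
     \<and> rescaled \<beta> y (proto k) \<in> rule \<sigma> (proto (kind p)) \<and> q = moved (scale p) (pos p) (Node \<beta> y k))"

definition split :: "'a node \<Rightarrow> 'a node \<Rightarrow> bool" where
  "split p q \<longleftrightarrow> 1 < scale p \<and> child p q"

definition leaves :: "'a node \<Rightarrow> 'a node set" where
  "leaves p = {q. split\<^sup>*\<^sup>* p q \<and> scale q \<le> 1}"

lemma proto_facts:
  assumes "j < length (prototiles \<sigma>)"
  shows "tile (proto j)" "tessellation (rule \<sigma> (proto j)) (proto j)" "finite (rule \<sigma> (proto j))"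
    "measure lebesgue (proto j) = 1" "proto j \<noteq> {}"
    "V \<in> rule \<sigma> (proto j) \<Longrightarrow> \<exists>\<beta> y k. 0 < \<beta> \<and> k < length (prototiles \<sigma>) \<and> V = rescaled \<beta> y (proto k)"
proof -
  have mem: "proto j \<in> set (prototiles \<sigma>)" using assms by simp
  then show "tile (proto j)" "tessellation (rule \<sigma> (proto j)) (proto j)"
      "finite (rule \<sigma> (proto j))"
    using scheme by (auto simp: multiscale_scheme_def)
  show "measure lebesgue (proto j) = 1" using mem normalized by (auto simp: normalized_def)
  then show "proto j \<noteq> {}" by auto
  assume "V \<in> rule \<sigma> (proto j)"
  then obtain k \<beta> where "tile_of_type \<sigma> k \<beta> V"
    using scheme mem unfolding multiscale_scheme_def by blast
  then show "\<exists>\<beta> y k. 0 < \<beta> \<and> k < length (prototiles \<sigma>) \<and> V = rescaled \<beta> y (proto k)"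
    unfolding tile_of_type_def by blast
qed

lemma tile_at_moved: "tile_at (moved s v p) = rescaled s v (tile_at p)"
  by (simp add: tile_at_def rescaled_rescaled)

lemma valid_moved: "0 < s \<Longrightarrow> valid (moved s v p) \<longleftrightarrow> valid p"
  by (simp add: valid_def zero_less_mult_iff)

lemma measure_tile_at: "valid p \<Longrightarrow> measure lebesgue (tile_at p) = scale p ^ DIM('a)"
  by (simp add: valid_def tile_at_def measure_rescaled proto_facts)

lemma measure_tile_at_le_1_iff: "valid p \<Longrightarrow> measure lebesgue (tile_at p) \<le> 1 \<longleftrightarrow> scale p \<le> 1"
  by (simp add: measure_tile_at valid_def power_le_one_iff)

text \<open>Types are distinguished by the geometric difference of the prototiles, scales by the volume, and
  positions by boundedness.\<close>

lemma tile_at_inject: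
  assumes "valid p" "valid q" "tile_at p = tile_at q"
  shows "p = q"
proof -
  have pos: "0 < scale p" "0 < scale q" using assms by (auto simp: valid_def)
  have kind: "kind p = kind q"
  proof (rule ccontr)
    assume neq: "kind p \<noteq> kind q"
    define s where "s = 1 / scale p"
    have "rescaled s (- (s *\<^sub>R pos p)) (tile_at p) = rescaled s (- (s *\<^sub>R pos p)) (tile_at q)"
      using assms by simp
    then have "proto (kind p) = rescaled (s * scale q) (- (s *\<^sub>R pos p) + s *\<^sub>R pos q) (proto (kind q))"
      using pos by (simp add: tile_at_def rescaled_rescaled s_def)
    moreover have "0 < s * scale q" using pos by (simp add: s_def)
    ultimately show False
      using scheme assms neq unfolding multiscale_scheme_def valid_def by blast
  qed
  have "scale p ^ DIM('a) = scale q ^ DIM('a)"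
    using assms measure_tile_at by metis
  then have scale: "scale p = scale q"
    using pos by (simp add: power_eq_iff_eq_base)
  have k: "kind q < length (prototiles \<sigma>)" using assms by (simp add: valid_def)
  have "pos p = pos q"
    using assms(3) proto_facts(1,5)[OF k]
    by (intro rescaled_position_unique[of "scale q" _ "proto (kind q)"])
      (auto simp: tile_at_def kind scale tile_def)
  then show ?thesis using kind scale by (simp add: node.expand)
qed

lemma child_valid: "valid p \<Longrightarrow> child p q \<Longrightarrow> valid q"
  by (auto simp: child_def valid_def)

lemma child_scale:
  assumes "valid p" "child p q"
  shows "c * scale p \<le> scale q" "scale q \<le> a * scale p"
  using assms ratio[of "kind p"] by (auto simp: child_def valid_def)

lemma child_tile:
  assumes "child p q"
  obtains V where "V \<in> rule \<sigma> (proto (kind p))" "tile_at q = rescaled (scale p) (pos p) V"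
proof -
  obtain \<beta> y k where q: "rescaled \<beta> y (proto k) \<in> rule \<sigma> (proto (kind p))"
      "q = moved (scale p) (pos p) (Node \<beta> y k)"
    using assms by (auto simp: child_def)
  have "tile_at q = rescaled (scale p) (pos p) (tile_at (Node \<beta> y k))"
    by (simp only: q tile_at_moved)
  then show thesis using that q(1) by (simp add: tile_at_def)
qed

lemma child_of_rule:
  assumes "valid p" "V \<in> rule \<sigma> (proto (kind p))"
  obtains q where "child p q" "tile_at q = rescaled (scale p) (pos p) V"
proof -
  obtain \<beta> y k where V: "0 < \<beta>" "k < length (prototiles \<sigma>)" "V = rescaled \<beta> y (proto k)"
    using proto_facts(6)[of "kind p" V] assms by (auto simp: valid_def)
  have "child p (moved (scale p) (pos p) (Node \<beta> y k))"
    using V assms unfolding child_def by blast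
  moreover have "tile_at (Node \<beta> y k) = V" using V by (simp add: tile_at_def)
  ultimately show thesis using that tile_at_moved by metis
qed

lemma child_subset:
  assumes "valid p" "child p q" shows "tile_at q \<subseteq> tile_at p"
proof -
  obtain V where V: "V \<in> rule \<sigma> (proto (kind p))" "tile_at q = rescaled (scale p) (pos p) V"
    using assms by (rule_tac child_tile)
  have "V \<subseteq> proto (kind p)"
    using V(1) proto_facts(2)[of "kind p"] assms by (auto simp: valid_def tessellation_def)
  then show ?thesis using V(2) by (simp add: tile_at_def rescaled_mono)
qed

lemma children_disjoint:
  assumes "valid p" "child p q" "child p q'" "q \<noteq> q'"
  shows "disjnt (interior (tile_at q)) (interior (tile_at q'))"
proof -
  obtain V where V: "V \<in> rule \<sigma> (proto (kind p))" "tile_at q = rescaled (scale p) (pos p) V"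
    using assms by (rule_tac child_tile)
  obtain V' where V': "V' \<in> rule \<sigma> (proto (kind p))" "tile_at q' = rescaled (scale p) (pos p) V'"
    using assms by (rule_tac child_tile)
  have "V \<noteq> V'" using assms V V' tile_at_inject child_valid by metis
  then have "disjnt (interior V) (interior V')"
    using V V' proto_facts(2)[of "kind p"] assms
    by (auto simp: valid_def tessellation_def pairwise_def)
  then show ?thesis
    using assms(1) by (simp add: V V' interior_rescaled valid_def)
      (auto simp: disjnt_def mem_rescaled_iff)
qed

lemma finite_children:
  assumes "valid p" shows "finite {q. child p q}"
proof -
  have "tile_at ` {q. child p q} \<subseteq> rescaled (scale p) (pos p) ` rule \<sigma> (proto (kind p))"
    by (auto elim: child_tile)
  moreover have "finite (rule \<sigma> (proto (kind p)))"
    using assms proto_facts(3) by (simp add: valid_def)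
  ultimately have "finite (tile_at ` {q. child p q})" by (meson finite_imageI finite_subset)
  moreover have "inj_on tile_at {q. child p q}"
    using assms child_valid tile_at_inject by (auto intro!: inj_onI)
  ultimately show ?thesis by (rule finite_imageD)
qed

lemma child_moved:
  assumes "child p q" shows "child (moved s v p) (moved s v q)"
  using assms unfolding child_def
  by (metis moved_moved moved_sel)

lemma child_movedD:
  assumes "child (moved s v p) q"
  obtains q' where "q = moved s v q'" "child p q'"
  using assms unfolding child_def
  by (metis moved_moved moved_sel)

text \<open>Substitution reaches scale at most 1 after finitely many steps, because every step shrinks the
  scale by the factor \<open>a\<close> at least.\<close>

lemma node_induct [consumes 1, case_names node]:
  assumes "valid p"
    and step: "\<And>p. valid p \<Longrightarrow> (\<And>q. 1 < scale p \<Longrightarrow> child p q \<Longrightarrow> P q) \<Longrightarrow> P p"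
  shows "P p"
proof -
  have a: "0 < a" "a < 1" using bounds by auto
  have main: "P p" if "valid p" "scale p * a ^ N \<le> 1" for N p
    using that
  proof (induction N arbitrary: p)
    case 0
    then show ?case using step by simp
  next
    case (Suc N)
    show ?case
    proof (rule step[OF Suc.prems(1)])
      fix q assume q: "child p q"
      have "scale q * a ^ N \<le> (a * scale p) * a ^ N"
        using child_scale(2)[OF Suc.prems(1) q] a by (intro mult_right_mono) auto
      then show "P q"
        using Suc.prems child_valid[OF _ q] by (intro Suc.IH) (auto simp: algebra_simps)
    qed
  qed
  have s: "0 < scale p" using assms(1) by (simp add: valid_def)
  obtain N where "a ^ N < 1 / scale p"
    using real_arch_pow_inv[of "1 / scale p" a] s a by auto
  then have "scale p * a ^ N \<le> 1" using s by (simp add: field_simps)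
  then show ?thesis using main assms(1) by blast
qed

lemma leaves_self: "scale p \<le> 1 \<Longrightarrow> leaves p = {p}"
  by (auto simp: leaves_def split_def elim: converse_rtranclpE)

lemma leaves_split: "1 < scale p \<Longrightarrow> leaves p = (\<Union>q\<in>{q. child p q}. leaves q)"
proof (intro set_eqI iffI)
  fix x assume big: "1 < scale p" and x: "x \<in> leaves p"
  then have "split\<^sup>*\<^sup>* p x" "p \<noteq> x" by (auto simp: leaves_def)
  then obtain q where "split p q" "split\<^sup>*\<^sup>* q x" by (blast elim: converse_rtranclpE)
  then show "x \<in> (\<Union>q\<in>{q. child p q}. leaves q)" using x by (auto simp: leaves_def split_def)
next
  fix x assume big: "1 < scale p" and x: "x \<in> (\<Union>q\<in>{q. child p q}. leaves q)"
  then obtain q where "split p q" "split\<^sup>*\<^sup>* q x" "scale x \<le> 1"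
    by (auto simp: leaves_def split_def)
  then show "x \<in> leaves p" by (simp add: leaves_def converse_rtranclp_into_rtranclp)
qed

lemma leaves_mono: "split\<^sup>*\<^sup>* p q \<Longrightarrow> leaves q \<subseteq> leaves p"
  by (auto simp: leaves_def)

lemma splits_valid: "split\<^sup>*\<^sup>* p q \<Longrightarrow> valid p \<Longrightarrow> valid q"
  by (induction rule: rtranclp_induct) (auto simp: split_def intro: child_valid)

lemma splits_subset: "split\<^sup>*\<^sup>* p q \<Longrightarrow> valid p \<Longrightarrow> tile_at q \<subseteq> tile_at p"
proof (induction rule: rtranclp_induct)
  case (step q q')
  then have "valid q" using splits_valid by blast
  then show ?case using step child_subset[of q q'] unfolding split_def by blast
qed simp

lemma splits_scale: "split\<^sup>*\<^sup>* p q \<Longrightarrow> valid p \<Longrightarrow> c \<le> scale p \<Longrightarrow> c \<le> scale q"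
proof (induction rule: rtranclp_induct)
  case (step q q')
  then have "valid q" using splits_valid by blast
  then have "c * scale q \<le> scale q'" "1 < scale q"
    using step child_scale(1) by (auto simp: split_def)
  moreover have "c * 1 \<le> c * scale q" using bounds \<open>1 < scale q\<close> by (intro mult_left_mono) auto
  ultimately show ?case by simp
qed

lemma leaves_disjoint:
  assumes "valid p" "q \<in> leaves p" "q' \<in> leaves p" "q \<noteq> q'"
  shows "disjnt (interior (tile_at q)) (interior (tile_at q'))"
  using assms
proof (induction p arbitrary: q q' rule: node_induct)
  case (node p)
  have "1 < scale p"
  proof (rule ccontr)
    assume "\<not> 1 < scale p"
    then show False using node.prems leaves_self[of p] by simp
  qed
  then obtain u u' where u: "child p u" "q \<in> leaves u" and u': "child p u'" "q' \<in> leaves u'"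
    using node.prems leaves_split by auto
  show ?case
  proof (cases "u = u'")
    case True
    then show ?thesis using node.IH[OF \<open>1 < scale p\<close>] u u' node.prems by blast
  next
    case False
    then have "disjnt (interior (tile_at u)) (interior (tile_at u'))"
      using children_disjoint node.hyps u u' by blast
    moreover have "interior (tile_at q) \<subseteq> interior (tile_at u)"
      "interior (tile_at q') \<subseteq> interior (tile_at u')"
      using u u' node.hyps child_valid splits_subset
      by (auto intro!: interior_mono simp: leaves_def) blast+
    ultimately show ?thesis by (auto simp: disjnt_def)
  qed
qed

text \<open>Iterating the rule exhibits \<open>T\<^sub>j\<close> as a union of arbitrarily small rescaled prototiles, each of which
  contains interior points of \<open>T\<^sub>j\<close>.\<close>

lemma proto_subset_closure_interior:
  assumes "j < length (prototiles \<sigma>)"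
  shows "proto j \<subseteq> closure (interior (proto j))"
proof
  fix z assume "z \<in> proto j"
  have approx: "\<exists>y\<in>interior (proto j). dist y z < a ^ N * D"
    if "z \<in> proto j" "j < length (prototiles \<sigma>)" for N j z
    using that
  proof (induction N arbitrary: j z)
    case 0
    have "0 \<in> interior (proto j)"
      using interior_maximal[OF inner[OF 0(2)] open_ball] bounds by auto
    moreover have "dist 0 z < D" using outer[OF 0(2)] 0(1) by auto
    ultimately show ?case by (intro bexI[of _ 0]) simp_all
  next
    case (Suc N)
    then obtain V where V: "V \<in> rule \<sigma> (proto j)" "z \<in> V"
      using proto_facts(2)[OF Suc.prems(2)] Suc.prems(1) unfolding tessellation_def by blast
    obtain \<beta> y k where k: "0 < \<beta>" "k < length (prototiles \<sigma>)" "V = rescaled \<beta> y (proto k)"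
      using proto_facts(6) V Suc.prems by blast
    have "\<beta> \<le> a" using ratio k V Suc.prems by blast
    obtain z' where z': "z' \<in> proto k" "z = y + \<beta> *\<^sub>R z'"
      using V k by (auto simp: rescaled_def)
    obtain w where w: "w \<in> interior (proto k)" "dist w z' < a ^ N * D"
      using Suc.IH k z' by blast
    have "dist (y + \<beta> *\<^sub>R w) z = \<beta> * dist w z'"
      using k by (simp add: z' dist_norm scaleR_right_diff_distrib[symmetric] del: scaleR_right_diff_distrib)
    also have "\<dots> \<le> a * dist w z'" using \<open>\<beta> \<le> a\<close> by (intro mult_right_mono) auto
    also have "\<dots> < a * (a ^ N * D)" using w bounds by (intro mult_strict_left_mono) auto
    finally have "dist (y + \<beta> *\<^sub>R w) z < a ^ Suc N * D" by simp
    moreover have "V \<subseteq> proto j"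
      using V(1) proto_facts(2) Suc.prems by (auto simp: tessellation_def)
    then have "y + \<beta> *\<^sub>R w \<in> interior (proto j)"
      using interior_mono[of V "proto j"] k w interior_rescaled[of \<beta> y "proto k"]
      by (auto simp: rescaled_def)
    ultimately show ?case by blast
  qed
  show "z \<in> closure (interior (proto j))"
    unfolding closure_approachable
  proof (intro allI impI)
    fix e :: real assume "0 < e"
    then obtain N where "a ^ N < e / D"
      using real_arch_pow_inv[of "e / D" a] bounds by auto
    then have "a ^ N * D < e" using bounds by (simp add: field_simps)
    then show "\<exists>y\<in>interior (proto j). dist y z < e"
      using approx[OF \<open>z \<in> proto j\<close> assms, of N] by force
  qed
qed

lemma tile_at_subset_ball:
  assumes "valid p" shows "tile_at p \<subseteq> ball (pos p) (scale p * D)"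
  using rescaled_mono[OF outer[of "kind p"], of "scale p" "pos p"] assms
  by (simp add: tile_at_def valid_def ball_rescaled)

lemma fat_patch_leaves:
  assumes "valid p" "c \<le> scale p"
  shows "fat_patch (c * r) D (tile_at ` leaves p)"
proof -
  have "tile_at q \<subseteq> closure (interior (tile_at q)) \<and> (\<exists>x. ball x (c * r) \<subseteq> tile_at q \<and> tile_at q \<subseteq> ball x D)"
    if "q \<in> leaves p" for q
  proof -
    have q: "valid q" "c \<le> scale q" "scale q \<le> 1"
      using \<open>q \<in> leaves p\<close> assms splits_valid splits_scale by (auto simp: leaves_def)
    then have k: "0 < scale q" "kind q < length (prototiles \<sigma>)" by (auto simp: valid_def)
    have "ball (pos q) (scale q * r) \<subseteq> tile_at q"
      using rescaled_mono[OF inner[OF k(2)], of "scale q" "pos q"] k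
      by (simp add: tile_at_def ball_rescaled)
    moreover have "c * r \<le> scale q * r" using q bounds by (intro mult_right_mono) auto
    ultimately have "ball (pos q) (c * r) \<subseteq> tile_at q" by (meson order.trans subset_ball)
    moreover have "tile_at q \<subseteq> ball (pos q) D"
    proof -
      have "scale q * D \<le> 1 * D" using q bounds by (intro mult_right_mono) auto
      then show ?thesis using tile_at_subset_ball[OF q(1)] by (auto intro: order.trans subset_ball)
    qed
    moreover have "tile_at q \<subseteq> closure (interior (tile_at q))"
      using rescaled_mono[OF proto_subset_closure_interior[OF k(2)]] k
      by (simp add: tile_at_def interior_rescaled closure_rescaled)
    ultimately show ?thesis by blast
  qed
  moreover have "pairwise (\<lambda>S T. disjnt (interior S) (interior T)) (tile_at ` leaves p)"
    using leaves_disjoint[OF assms(1)] by (auto simp: pairwise_def)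
  ultimately show ?thesis by (auto simp: fat_patch_def)
qed

lemma flow_eq_leaves:
  assumes "i < length (prototiles \<sigma>)"
  shows "flow \<sigma> t i = tile_at ` leaves (Node (exp t) 0 i)"
proof -
  let ?root = "Node (exp t) (0::'a) i"
  have root: "valid ?root" using assms by (simp add: valid_def)
  have "U \<in> flow_tiles \<sigma> t i \<Longrightarrow> \<exists>q. split\<^sup>*\<^sup>* ?root q \<and> U = tile_at q" for U
  proof (induction rule: flow_tiles.induct)
    case start
    then show ?case by (auto simp: tile_at_def intro!: exI[of _ ?root])
  next
    case (subst \<alpha> x j V)
    let ?p = "Node \<alpha> x j"
    obtain q where q: "split\<^sup>*\<^sup>* ?root q" "rescaled \<alpha> x (proto j) = tile_at q" using subst by blast
    have p: "valid ?p" using subst by (simp add: valid_def)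
    have "tile_at ?p = tile_at q" using q by (simp add: tile_at_def)
    then have eq: "q = ?p" using tile_at_inject splits_valid root q p by metis
    obtain u where u: "child ?p u" "tile_at u = rescaled \<alpha> x V"
      using child_of_rule[OF p, of V] subst by auto
    have "1 < scale ?p"
      using measure_tile_at_le_1_iff[OF p] subst by (simp add: tile_at_def)
    then have "split ?p u" using u by (simp add: split_def)
    then have "split\<^sup>*\<^sup>* ?root u"
      using q(1) unfolding eq by (rule rtranclp.rtrancl_into_rtrancl[rotated])
    then show ?case using u by metis
  qed
  moreover have "tile_at q \<in> flow_tiles \<sigma> t i" if "split\<^sup>*\<^sup>* ?root q" for q
    using that
  proof (induction rule: rtranclp_induct)
    case base
    then show ?case using flow_tiles.start[where \<sigma> = \<sigma> and t = t and i = i] by (simp add: tile_at_def)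
  next
    case (step p q)
    have p: "valid p" using step splits_valid root by blast
    have pq: "1 < scale p" "child p q" using step by (simp_all add: split_def)
    obtain V where V: "V \<in> rule \<sigma> (proto (kind p))" "tile_at q = rescaled (scale p) (pos p) V"
      using pq(2) by (rule child_tile)
    have "1 < measure lebesgue (tile_at p)"
      using measure_tile_at_le_1_iff[OF p] pq by simp
    then show ?case
      unfolding V(2) using step.IH p V(1)
      by (rule_tac j = "kind p" in flow_tiles.subst) (simp_all add: tile_at_def valid_def)
  qed
  ultimately have tiles: "flow_tiles \<sigma> t i = tile_at ` {q. split\<^sup>*\<^sup>* ?root q}" by blast
  have "measure lebesgue (tile_at q) \<le> 1 \<longleftrightarrow> scale q \<le> 1" if "split\<^sup>*\<^sup>* ?root q" for q
    using measure_tile_at_le_1_iff splits_valid root that by blast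
  then show ?thesis by (auto simp: flow_def tiles leaves_def)
qed

text \<open>The semi-flow is continuous from the left. A tile is split only if its scale exceeds 1, which is an
  open condition, and there are only finitely many tiles to split. So shrinking the initial tile
  slightly changes none of the decisions, and the resulting patches are similar.\<close>

lemma leaves_moved:
  assumes "valid p"
  shows "\<exists>\<delta>>0. \<forall>s v. 1 - \<delta> < s \<longrightarrow> s \<le> 1 \<longrightarrow> leaves (moved s v p) = moved s v ` leaves p"
  using assms
proof (induction p rule: node_induct)
  case (node p)
  have p: "0 < scale p" using node by (simp add: valid_def)
  show ?case
  proof (cases "scale p \<le> 1")
    case True
    have "leaves (moved s v p) = moved s v ` leaves p" if "s \<le> 1" for s v
    proof -
      have "s * scale p \<le> 1 * scale p" using p that by (intro mult_right_mono) auto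
      then have "scale (moved s v p) \<le> 1" using True by simp
      then show ?thesis using True by (simp add: leaves_self)
    qed
    then show ?thesis by (intro exI[of _ 1]) auto
  next
    case False
    then have big: "1 < scale p" by simp
    obtain \<delta> where \<delta>: "\<And>q. child p q \<Longrightarrow> 0 < \<delta> q" "\<And>q s v. \<lbrakk>child p q; 1 - \<delta> q < s; s \<le> 1\<rbrakk> \<Longrightarrow>
        leaves (moved s v q) = moved s v ` leaves q"
      using node.IH[OF big] by metis
    define \<epsilon> where "\<epsilon> = Min (insert (1 - 1 / scale p) (\<delta> ` {q. child p q}))"
    have fin: "finite (insert (1 - 1 / scale p) (\<delta> ` {q. child p q}))"
      using finite_children[OF node.hyps] by simp
    have "0 < \<epsilon>" unfolding \<epsilon>_def
      using fin \<delta>(1) big by (subst Min_gr_iff) auto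
    moreover have "leaves (moved s v p) = moved s v ` leaves p" if s: "1 - \<epsilon> < s" "s \<le> 1" for s v
    proof -
      have "\<epsilon> \<le> 1 - 1 / scale p" unfolding \<epsilon>_def using fin by (rule Min_le) simp
      then have "1 / scale p < s" using s by simp
      then have big': "1 < scale (moved s v p)" using p by (simp add: field_simps)
      have "leaves (moved s v q) = moved s v ` leaves q" if "child p q" for q
      proof -
        have "\<epsilon> \<le> \<delta> q" unfolding \<epsilon>_def using fin that by (intro Min_le) auto
        then show ?thesis using \<delta>(2)[OF that] s by simp
      qed
      moreover have "{q. child (moved s v p) q} = moved s v ` {q. child p q}"
        using child_moved by (auto elim!: child_movedD)
      ultimately show ?thesis
        using leaves_split[OF big'] leaves_split[OF big] by auto
    qed
    ultimately show ?thesis by blast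
  qed
qed

section \<open>Path lengths\<close>

text \<open>Logarithms turn the products of ratios along a line of descent into sums. A descendant at length
  \<open>l\<close> from a tile of scale \<open>exp w\<close> has scale \<open>exp (w - l)\<close>.\<close>

definition path_length :: "nat \<Rightarrow> nat \<Rightarrow> real \<Rightarrow> bool" where
  "path_length j i l \<longleftrightarrow> (\<exists>x. child\<^sup>*\<^sup>* (Node 1 0 j) (Node (exp (- l)) x i))"

lemma children_moved: "child\<^sup>*\<^sup>* p q \<Longrightarrow> child\<^sup>*\<^sup>* (moved s v p) (moved s v q)"
  by (induction rule: rtranclp_induct) (auto intro: child_moved rtranclp.rtrancl_into_rtrancl)

lemma path_length_add:
  assumes "path_length j k l" "path_length k i l'" shows "path_length j i (l + l')"
proof -
  obtain x where x: "child\<^sup>*\<^sup>* (Node 1 0 j) (Node (exp (- l)) x k)"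
    using assms by (auto simp: path_length_def)
  obtain y where "child\<^sup>*\<^sup>* (Node 1 0 k) (Node (exp (- l')) y i)"
    using assms by (auto simp: path_length_def)
  then have "child\<^sup>*\<^sup>* (moved (exp (- l)) x (Node 1 0 k)) (moved (exp (- l)) x (Node (exp (- l')) y i))"
    by (rule children_moved)
  then have "child\<^sup>*\<^sup>* (Node (exp (- l)) x k) (Node (exp (- (l + l'))) (x + exp (- l) *\<^sub>R y) i)"
    by (simp add: moved_def exp_add[symmetric])
  then show ?thesis using x unfolding path_length_def by (meson rtranclp_trans)
qed

lemma path_length_mult:
  assumes "path_length i i l" shows "path_length i i (real n * l)"
proof (induction n)
  case 0
  then show ?case by (auto simp: path_length_def intro!: exI[of _ 0])
next
  case (Suc n)
  then show ?case using path_length_add[OF assms Suc] by (simp add: algebra_simps)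
qed

lemma path_length_flow:
  assumes "i < length (prototiles \<sigma>)" "U \<in> flow \<sigma> t i" "tile_of_type \<sigma> j \<alpha> U"
  shows "path_length i j (t - ln \<alpha>)"
proof -
  let ?root = "Node (exp t) (0::'a) i"
  obtain q where q: "split\<^sup>*\<^sup>* ?root q" "U = tile_at q"
    using assms flow_eq_leaves by (auto simp: leaves_def)
  obtain x where x: "U = rescaled \<alpha> x (proto j)" "0 < \<alpha>" "j < length (prototiles \<sigma>)"
    using assms by (auto simp: tile_of_type_def)
  have root: "valid ?root" using assms by (simp add: valid_def)
  have "q = Node \<alpha> x j"
  proof (rule tile_at_inject)
    show "valid q" using q root splits_valid by blast
    show "valid (Node \<alpha> x j)" using x by (simp add: valid_def)
    show "tile_at q = tile_at (Node \<alpha> x j)" using q x by (simp add: tile_at_def)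
  qed
  moreover have "child\<^sup>*\<^sup>* ?root q"
    by (rule rtranclp_mono[THEN predicate2D, OF _ q(1)]) (auto simp: split_def)
  ultimately have "child\<^sup>*\<^sup>* (moved (exp (- t)) 0 ?root) (moved (exp (- t)) 0 (Node \<alpha> x j))"
    by (intro children_moved) simp
  moreover have "exp (- t) * \<alpha> = exp (- (t - ln \<alpha>))"
    using x by (simp add: exp_diff exp_minus field_simps)
  ultimately show ?thesis
    by (auto simp: path_length_def moved_def exp_add[symmetric])
qed

text \<open>The scale drops by the factor \<open>a\<close> at least in each step. So if the last scale is above \<open>a\<close>, all
  earlier ones are above 1, and the whole line of descent is realized by the semi-flow.\<close>

lemma splits_of_children:
  assumes "child\<^sup>*\<^sup>* p q" "valid p" "a < scale q"
  shows "split\<^sup>*\<^sup>* p q"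
  using assms
proof (induction rule: rtranclp_induct)
  case (step q q')
  have "valid q" using step(1,4) by (induction rule: rtranclp_induct) (auto intro: child_valid)
  then have "a * 1 < a * scale q" using child_scale(2) step by fastforce
  then have "1 < scale q" using bounds by (simp add: mult_less_cancel_left)
  then show ?case
    using step bounds by (auto simp: split_def intro: rtranclp.rtrancl_into_rtrancl)
qed auto

text \<open>The last tile of scale at least \<open>M\<close> on the way from \<open>p\<close> to \<open>q\<close>.\<close>

lemma splits_intermediate:
  assumes "split\<^sup>*\<^sup>* p q" "valid p" "M \<le> scale p" "scale q < M"
  shows "\<exists>u. split\<^sup>*\<^sup>* p u \<and> split\<^sup>*\<^sup>* u q \<and> M \<le> scale u \<and> c * scale u < M"
  using assms
proof (induction rule: converse_rtranclp_induct)
  case (step p p')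
  have p': "valid p'" using step child_valid by (auto simp: split_def)
  show ?case
  proof (cases "M \<le> scale p'")
    case True
    then show ?thesis
      using step p' by (meson converse_rtranclp_into_rtranclp)
  next
    case False
    then have "c * scale p < M"
      using child_scale(1)[of p p'] step by (auto simp: split_def)
    then show ?thesis
      using step by (meson converse_rtranclp_into_rtranclp rtranclp.rtrancl_refl)
  qed
qed auto

text \<open>The two loops provided by incommensurability, of lengths \<open>t1\<close> and \<open>t2\<close>, can be run through any
  number of times. Irreducibility connects every type to the first loop, the first loop to the second
  one, and the second one to \<open>i\<close>. So the lengths of paths contain a fixed translate of the combinations
  of \<open>t1\<close> and \<open>t2\<close>.\<close>

lemma path_lengths_eventually_dense:
  assumes irr: "irreducible_scheme \<sigma>" and inc: "incommensurable \<sigma>"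
    and i: "i < length (prototiles \<sigma>)" and "0 < \<eta>"
  shows "\<exists>W. \<forall>w\<ge>W. \<forall>j<length (prototiles \<sigma>). \<exists>l. path_length j i l \<and> w \<le> l \<and> l < w + \<eta>"
proof -
  let ?n = "length (prototiles \<sigma>)"
  obtain g h t1 t2 U1 U2 \<alpha>1 \<alpha>2 where gh: "g < ?n" "h < ?n" "0 < t1" "0 < t2"
      "\<not> (\<exists>q\<in>\<rat>. t1 = q * t2)"
    and U1: "U1 \<in> flow \<sigma> t1 g" "tile_of_type \<sigma> g \<alpha>1 U1" "measure lebesgue U1 = 1"
    and U2: "U2 \<in> flow \<sigma> t2 h" "tile_of_type \<sigma> h \<alpha>2 U2" "measure lebesgue U2 = 1"
    using inc unfolding incommensurable_def by blast
  have unit: "\<alpha> = 1" if U: "tile_of_type \<sigma> k \<alpha> U" "measure lebesgue U = 1" for k \<alpha> U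
  proof -
    obtain x where "U = tile_at (Node \<alpha> x k)" "valid (Node \<alpha> x k)" "0 < \<alpha>"
      using U by (auto simp: tile_of_type_def tile_at_def valid_def)
    then show ?thesis using U measure_tile_at[of "Node \<alpha> x k"] power_eq_iff_eq_base[of "DIM('a)" \<alpha> 1] by simp
  qed
  have g: "path_length g g t1" and h: "path_length h h t2"
    using path_length_flow[OF gh(1) U1(1,2)] path_length_flow[OF gh(2) U2(1,2)]
      unit[OF U1(2,3)] unit[OF U2(2,3)] by simp_all
  have connect: "\<exists>l. path_length j k l" if "j < ?n" "k < ?n" for j k
    using irr that path_length_flow unfolding irreducible_scheme_def by blast
  obtain l1 where l1: "path_length g h l1" using connect gh by blast
  obtain l2 where l2: "path_length h i l2" using connect gh i by blast
  have "\<forall>j<?n. \<exists>l. path_length j g l" using connect gh by blast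
  then obtain L where L: "\<And>j. j < ?n \<Longrightarrow> path_length j g (L j)" by metis
  obtain W where W: "\<forall>w\<ge>W. \<exists>(m::nat) (n::nat). w \<le> m * t1 + n * t2 \<and> m * t1 + n * t2 < w + \<eta>"
    using combinations_eventually_dense gh \<open>0 < \<eta>\<close> by blast
  define B where "B = Max (L ` {..<?n})"
  have "\<exists>l. path_length j i l \<and> w \<le> l \<and> l < w + \<eta>" if w: "W + B + l1 + l2 \<le> w" and j: "j < ?n" for w j
  proof -
    have "L j \<le> B" unfolding B_def using j by (intro Max_ge) auto
    then have "W \<le> w - L j - l1 - l2" using w by simp
    then obtain m n :: nat where mn: "w - L j - l1 - l2 \<le> m * t1 + n * t2"
        "m * t1 + n * t2 < w - L j - l1 - l2 + \<eta>"
      using W by blast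
    have "path_length j i (L j + (m * t1 + (l1 + (n * t2 + l2))))"
      by (intro path_length_add[OF L[OF j]] path_length_add[OF path_length_mult[OF g]]
          path_length_add[OF l1] path_length_add[OF path_length_mult[OF h]] l2)
    then show ?thesis using mn by (intro exI conjI) auto
  qed
  then show ?thesis by blast
qed

section \<open>Minimality\<close>

text \<open>The translates of the patches \<open>F\<^sub>t(T\<^sub>i)\<close>, \<open>t \<ge> 0\<close>.\<close>

definition generated :: "'a set set set" where
  "generated = {tile_at ` leaves p |p. valid p \<and> 1 \<le> scale p}"

lemma leaves_translate: "valid p \<Longrightarrow> leaves (moved 1 v p) = moved 1 v ` leaves p"
  using leaves_moved[of p] by force

lemma translate_leaves:
  "valid p \<Longrightarrow> translate v (tile_at ` leaves p) = tile_at ` leaves (moved 1 v p)"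
  by (simp add: translate_eq_rescaled leaves_translate image_image tile_at_moved)

lemma fat_generated: "P \<in> generated \<Longrightarrow> fat_patch (c * r) D P"
  using fat_patch_leaves bounds by (auto simp: generated_def)

lemma locally_from_generated:
  assumes "\<T> \<in> tiling_space \<sigma>" shows "locally_from generated \<T>"
  unfolding locally_from_def
proof (intro allI impI)
  fix Q and e :: real assume "sub_patch Q \<T>" and e: "0 < e" "e \<le> 1"
  then obtain p where p: "patch_limit p Q"
      "\<And>k. \<exists>P\<in>generating_patches \<sigma>. \<exists>S x. sub_patch S P \<and> p k = translate x S"
    using assms unfolding tiling_space_def by blast
  have "\<forall>\<^sub>F k in sequentially. close_at e (skeleton (p k)) (skeleton Q)
      \<and> close_at e (support (p k)) (support Q)"
    using p(1) e unfolding patch_limit_def set_dist_tendsto_0_iff by (simp add: eventually_conj)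
  then obtain k where k: "close_at e (skeleton (p k)) (skeleton Q)"
      "close_at e (support (p k)) (support Q)"
    unfolding eventually_sequentially by blast
  obtain t i S x where S: "0 \<le> t" "i < length (prototiles \<sigma>)" "sub_patch S (flow \<sigma> t i)"
      "p k = translate x S"
    using p(2)[of k] unfolding generating_patches_def by blast
  let ?root = "Node (exp t) (0::'a) i"
  have "valid (moved 1 x ?root)" "1 \<le> scale (moved 1 x ?root)" using S by (simp_all add: valid_def)
  then have "tile_at ` leaves (moved 1 x ?root) \<in> generated" unfolding generated_def by blast
  then have "translate x (flow \<sigma> t i) \<in> generated"
    using S by (simp add: flow_eq_leaves translate_leaves valid_def)
  moreover have "p k \<subseteq> translate x (flow \<sigma> t i)"
    using S by (auto simp: sub_patch_def translate_def)
  ultimately show "\<exists>P\<in>generated. \<exists>S\<subseteq>P. close_at e (skeleton S) (skeleton Q)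
      \<and> close_at e (support S) (support Q)"
    using k by blast
qed

lemma skeleton_leaves_subset_cball:
  assumes "valid p" shows "skeleton (tile_at ` leaves p) \<subseteq> cball (pos p) (scale p * D)"
proof -
  have "closure (tile_at q) \<subseteq> cball (pos p) (scale p * D)" if "q \<in> leaves p" for q
  proof -
    have "tile_at q \<subseteq> tile_at p" using splits_subset assms that by (simp add: leaves_def)
    then have "tile_at q \<subseteq> cball (pos p) (scale p * D)"
      using tile_at_subset_ball[OF assms] ball_subset_cball by blast
    then show ?thesis by (simp add: closure_minimal)
  qed
  then have "(\<Union>V\<in>tile_at ` leaves p. frontier V) \<subseteq> cball (pos p) (scale p * D)"
    by (auto simp: frontier_def)
  then show ?thesis unfolding skeleton_def by (simp add: closure_minimal)
qed

text \<open>Every tile that is large enough has, among its descendants, a copy of \<open>p\<close> shrunk by as little as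
  desired. The bound \<open>M\<close> depends neither on the type of the large tile nor on its scale, and this
  uniformity is the heart of minimality.\<close>

lemma descendant_of_prescribed_scale:
  assumes "irreducible_scheme \<sigma>" "incommensurable \<sigma>"
    and "valid p" "1 \<le> scale p" "m < 1"
  shows "\<exists>M>1. \<forall>q. valid q \<longrightarrow> M \<le> scale q \<longrightarrow>
    (\<exists>s x. m < s \<and> s \<le> 1 \<and> split\<^sup>*\<^sup>* q (moved s x p))"
proof -
  \<comment> \<open>The factor \<open>s\<close> is also kept above \<open>a\<close>, so that no ancestor of the copy has stopped splitting.\<close>
  define m' where "m' = max m a"
  have m': "0 < m'" "m' < 1" "m \<le> m'" "a \<le> m'" using assms bounds by (auto simp: m'_def)
  have i: "kind p < length (prototiles \<sigma>)" and sp: "0 < scale p" using assms by (auto simp: valid_def)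
  have "0 < - ln m'" using m' by simp
  then obtain W where W: "\<And>w j. \<lbrakk>W \<le> w; j < length (prototiles \<sigma>)\<rbrakk> \<Longrightarrow>
      \<exists>l. path_length j (kind p) l \<and> w \<le> l \<and> l < w + - ln m'"
    using path_lengths_eventually_dense[OF assms(1,2) i] by meson
  define M where "M = max 2 (scale p * exp W)"
  have "\<exists>s x. m < s \<and> s \<le> 1 \<and> split\<^sup>*\<^sup>* q (moved s x p)" if q: "valid q" "M \<le> scale q" for q
  proof -
    have sq: "0 < scale q" using q by (simp add: valid_def)
    \<comment> \<open>The copy has scale \<open>exp (w - l) * scale p\<close>, so \<open>l\<close> is sought just above \<open>w\<close>.\<close>
    define w where "w = ln (scale q / scale p)"
    have "exp W \<le> scale q / scale p" using q sp by (simp add: M_def field_simps)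
    then have "W \<le> w" unfolding w_def using sq sp by (simp add: ln_ge_iff)
    then obtain l where l: "path_length (kind q) (kind p) l" "w \<le> l" "l < w + - ln m'"
      using W[of w "kind q"] q by (auto simp: valid_def)
    then obtain x where x: "child\<^sup>*\<^sup>* (Node 1 0 (kind q)) (Node (exp (- l)) x (kind p))"
      by (auto simp: path_length_def)
    define u where "u = moved (scale q) (pos q) (Node (exp (- l)) x (kind p))"
    define s where "s = exp (w - l)"
    have "scale u = s * scale p"
      using sq sp by (simp add: u_def s_def w_def exp_diff exp_minus field_simps)
    then have u: "u = moved s (pos u - s *\<^sub>R pos p) p"
      by (intro node.expand) (simp add: u_def)
    have "moved (scale q) (pos q) (Node 1 0 (kind q)) = q"
      by (intro node.expand) simp
    then have "child\<^sup>*\<^sup>* q u"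
      using children_moved[OF x, of "scale q" "pos q"] by (simp add: u_def)
    moreover have "s \<le> 1" using l by (simp add: s_def)
    moreover have "ln m' < w - l" using l by simp
    then have "m' < s" unfolding s_def using m' by (metis exp_less_cancel_iff exp_ln)
    moreover have "a < scale u"
    proof -
      have "a < s" using \<open>m' < s\<close> m' by simp
      moreover have "s * 1 \<le> s * scale p" using assms by (intro mult_left_mono) (simp_all add: s_def)
      ultimately show ?thesis using \<open>scale u = s * scale p\<close> by simp
    qed
    ultimately have "split\<^sup>*\<^sup>* q u" using splits_of_children q by blast
    then show ?thesis
      using u \<open>m' < s\<close> \<open>s \<le> 1\<close> m' by (metis order_le_less_trans)
  qed
  moreover have "1 < M" by (simp add: M_def)
  ultimately show ?thesis by blast
qed

text \<open>Two points at distance \<open>K / 2\<close> are close to a tile of diameter at most \<open>2 * scale p * D\<close>.\<close>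

lemma scale_of_dense_leaves:
  assumes "valid p" and dense: "ball 0 K \<subseteq> neighborhood 1 (\<Union>(tile_at ` leaves p))"
    and "4 * (M * D) + 4 < K" "0 < K"
  shows "M \<le> scale p"
proof -
  obtain b :: 'a where b: "norm b = K / 2" using vector_choose_size[of "K / 2"] assms by auto
  have "\<exists>z. dist z y < 1 \<and> dist (pos p) z < scale p * D" if y: "y \<in> ball 0 K" for y
  proof -
    obtain q z where z: "q \<in> leaves p" "z \<in> tile_at q" "dist z y < 1"
      using dense y unfolding subset_iff mem_neighborhood by blast
    have "tile_at q \<subseteq> tile_at p" using z splits_subset assms by (simp add: leaves_def)
    then have "z \<in> ball (pos p) (scale p * D)" using z tile_at_subset_ball[OF assms(1)] by blast
    then show ?thesis using z by auto
  qed
  then obtain z0 z1 where "dist z0 0 < 1" "dist (pos p) z0 < scale p * D"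
      "dist z1 b < 1" "dist (pos p) z1 < scale p * D"
    using b assms by (metis dist_0_norm half_gt_zero_iff mem_ball field_sum_of_halves less_add_same_cancel1 centre_in_ball)
  moreover have "dist b 0 \<le> dist z1 b + dist (pos p) z1 + dist (pos p) z0 + dist z0 0"
    using dist_triangle[of b 0 z1] dist_triangle[of z1 0 "pos p"] dist_triangle[of "pos p" 0 z0]
    by (simp add: dist_commute)
  ultimately have "K / 2 < 2 + 2 * (scale p * D)" using b by simp
  then have "M * D < scale p * D" using assms by simp
  then show ?thesis using bounds by (simp add: mult_less_cancel_right)
qed

text \<open>Near the origin \<open>\<T>'\<close> looks like the patch \<open>P'\<close> grown from a node \<open>p\<close>, and on a very large ball \<open>\<T>\<close>
  looks like a patch \<open>P\<close>. The tile of \<open>P\<close> at the origin has an ancestor \<open>b\<close> of bounded but large scale,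
  and \<open>b\<close> has a descendant that is a slightly shrunk copy of \<open>p\<close>. The leaves of this descendant form a
  patch inside \<open>P\<close>, at bounded distance from the origin, which the translation by \<open>v\<close> carries
  almost onto \<open>P'\<close>.\<close>

lemma skeleton_near_translate:
  assumes irr: "irreducible_scheme \<sigma>" and inc: "incommensurable \<sigma>"
    and T: "\<T> \<in> tiling_space \<sigma>" and T': "\<T>' \<in> tiling_space \<sigma>" and "0 < R" "0 < e"
  shows "\<exists>v. near R e (skeleton \<T>') (skeleton (translate v \<T>))"
proof -
  \<comment> \<open>Three approximations of precision \<open>d\<close> will be composed. The bound by \<open>c * r / 2\<close> makes supports
    that are \<open>2 * d\<close>-dense enter the ball inside every tile.\<close>
  define d where "d = min (min 1 (e / 4)) (c * r / 2)"
  have cr: "0 < c * r" using bounds by simp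
  then have d: "0 < d" "d \<le> 1" "4 * d \<le> e" "2 * d \<le> c * r"
    using assms by (auto simp: d_def)
  define R1 where "R1 = R + 3 * d + D"
  have R1: "0 < R1" using assms d bounds by (simp add: R1_def)
  obtain P' where P': "P' \<in> generated" "near R1 d (skeleton \<T>') (skeleton P')"
      "ball 0 R1 \<subseteq> neighborhood d (\<Union>P')"
    using near_generating_patch[OF fat_generated cr bounds(5) _ locally_from_generated[OF T'] R1 d(1)]
      T' by (auto simp: tiling_space_def)
  then obtain p where p: "valid p" "1 \<le> scale p" "P' = tile_at ` leaves p"
    by (auto simp: generated_def)
  obtain \<delta> where \<delta>: "0 < \<delta>" "\<And>s v. \<lbrakk>1 - \<delta> < s; s \<le> 1\<rbrakk> \<Longrightarrow> leaves (moved s v p) = moved s v ` leaves p"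
    using leaves_moved[OF p(1)] by blast
  have pD: "0 < scale p * D" using p bounds by simp
  \<comment> \<open>Shrinking by a factor above \<open>m\<close> keeps the combinatorics and moves no point of the tile of \<open>p\<close>
    by \<open>d\<close> or more.\<close>
  define m where "m = max (max (1 - \<delta>) (1 - d / (scale p * D))) 0"
  have "m < 1" using \<delta> d pD by (auto simp: m_def)
  then obtain M where M: "1 < M" "\<And>q. \<lbrakk>valid q; M \<le> scale q\<rbrakk> \<Longrightarrow>
      \<exists>s x. m < s \<and> s \<le> 1 \<and> split\<^sup>*\<^sup>* q (moved s x p)"
    using descendant_of_prescribed_scale[OF irr inc p(1,2)] by meson
  \<comment> \<open>The ball must contain the translate of the observed region that is found below; the last two
    summands force the patch to descend from a tile of scale at least \<open>M\<close>.\<close>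
  define K where "K = R + 3 * d + norm (pos p) + (1 + 2 * (M / c * D)) + 4 * (M * D) + 4"
  have "0 < M / c * D" "0 < M * D" using M bounds by simp_all
  then have K: "0 < K" "4 * (M * D) + 4 < K"
      "R + 3 * d + norm (pos p) + (1 + 2 * (M / c * D)) \<le> K"
    using assms d norm_ge_zero[of "pos p"] unfolding K_def by linarith+
  obtain P where P: "P \<in> generated" "near K d (skeleton \<T>) (skeleton P)"
      "ball 0 K \<subseteq> neighborhood d (\<Union>P)"
    using near_generating_patch[OF fat_generated cr bounds(5) _ locally_from_generated[OF T] K(1) d(1)]
      T by (auto simp: tiling_space_def)
  then obtain g where g: "valid g" "1 \<le> scale g" "P = tile_at ` leaves g"
    by (auto simp: generated_def)
  have "neighborhood d (\<Union>P) \<subseteq> neighborhood 1 (\<Union>P)"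
    using d unfolding subset_iff mem_neighborhood by (meson order_less_le_trans)
  then have dense1: "ball 0 K \<subseteq> neighborhood 1 (\<Union>(tile_at ` leaves g))" using P g by blast
  have "M \<le> scale g" by (rule scale_of_dense_leaves[OF g(1) dense1 K(2,1)])
  have "0 \<in> ball (0::'a) K" using K by simp
  then obtain q z0 where z0: "q \<in> leaves g" "z0 \<in> tile_at q" "dist z0 0 < 1"
    using dense1 unfolding subset_iff mem_neighborhood by blast
  then have "split\<^sup>*\<^sup>* g q" "scale q < M" using M by (auto simp: leaves_def)
  then obtain b where b: "split\<^sup>*\<^sup>* g b" "split\<^sup>*\<^sup>* b q" "M \<le> scale b" "c * scale b < M"
    using splits_intermediate g \<open>M \<le> scale g\<close> by blast
  have vb: "valid b" using b g splits_valid by blast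
  obtain s x where s: "m < s" "s \<le> 1" "split\<^sup>*\<^sup>* b (moved s x p)" using M(2) vb b by blast
  let ?u = "moved s x p"
  have s0: "0 < s" "1 - \<delta> < s" "1 - d / (scale p * D) < s" using s by (auto simp: m_def)
  have vu: "valid ?u" using vb s splits_valid by blast
  define v where "v = pos p - pos ?u"
  have v: "R + 3 * d + norm v \<le> K"
  proof -
    have "ball 0 r \<subseteq> proto (kind ?u)" using vu inner by (simp add: valid_def)
    then have "0 \<in> proto (kind ?u)" using bounds by auto
    then have "pos ?u \<in> tile_at ?u" by (force simp: tile_at_def rescaled_def)
    then have "dist (pos b) (pos ?u) < scale b * D"
      using splits_subset[OF s(3) vb] tile_at_subset_ball[OF vb] by auto
    moreover have "dist (pos b) z0 < scale b * D"
      using z0 splits_subset[OF b(2) vb] tile_at_subset_ball[OF vb] by auto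
    moreover have "norm (pos ?u) \<le> dist (pos b) (pos ?u) + dist (pos b) z0 + dist z0 0"
      using dist_triangle[of "pos ?u" 0 "pos b"] dist_triangle[of "pos b" 0 z0]
      by (simp add: dist_commute)
    ultimately have "norm (pos ?u) \<le> 1 + 2 * (scale b * D)" using z0 by simp
    moreover have "scale b * D \<le> M / c * D"
      using b bounds by (intro mult_right_mono) (auto simp: field_simps)
    moreover have "norm v \<le> norm (pos p) + norm (pos ?u)"
      unfolding v_def by (rule norm_triangle_ineq4)
    ultimately show ?thesis using K(3) by simp
  qed
  define E where "E = translate v P"
  define L where "L = translate v (tile_at ` leaves ?u)"
  have fatE: "fat_patch (c * r) D E"
  proof -
    have "valid (moved 1 v g)" "c \<le> scale (moved 1 v g)" using g bounds by (simp_all add: valid_moved)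
    then show ?thesis using fat_patch_leaves g by (simp add: E_def translate_leaves)
  qed
  have LE: "L \<subseteq> E"
    using leaves_mono[OF rtranclp_trans[OF b(1) s(3)]] g by (auto simp: L_def E_def translate_def)
  \<comment> \<open>The patch \<open>L\<close> is \<open>P'\<close> contracted towards the position of \<open>p\<close>.\<close>
  define h where "h = (1 - s) *\<^sub>R pos p"
  have L: "L = rescaled s h ` P'"
  proof -
    have "v + x = h" by (simp add: v_def h_def algebra_simps)
    then show ?thesis
      using \<delta>(2)[OF s0(2) s(2)]
      by (simp add: L_def translate_eq_rescaled p image_image tile_at_moved rescaled_rescaled)
  qed
  have move: "dist (h + s *\<^sub>R z) z < d" if z: "z \<in> cball (pos p) (scale p * D)" for z
  proof -
    have "h + s *\<^sub>R z - z = (1 - s) *\<^sub>R (pos p - z)" by (simp add: h_def algebra_simps)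
    then have "dist (h + s *\<^sub>R z) z = (1 - s) * dist (pos p) z"
      using s by (simp add: dist_norm)
    also have "\<dots> \<le> (1 - s) * (scale p * D)" using s z by (intro mult_left_mono) auto
    also have "\<dots> < d / (scale p * D) * (scale p * D)"
      using s0(3) pD by (intro mult_strict_right_mono) auto
    also have "\<dots> = d" using pD by (metis less_irrefl nonzero_eq_divide_eq)
    finally show ?thesis .
  qed
  have near1: "near S d (skeleton P') (skeleton L)" for S
  proof -
    have L': "skeleton L = rescaled s h (skeleton P')" using s0 by (simp add: L skeleton_rescaled)
    have "skeleton P' \<subseteq> cball (pos p) (scale p * D)"
      using skeleton_leaves_subset_cball p by simp
    then have close: "dist (h + s *\<^sub>R z) z < d" if "z \<in> skeleton P'" for z using move that by blast
    have "x \<in> neighborhood d (skeleton L)" if "x \<in> skeleton P'" for x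
      using close[OF that] that unfolding L' mem_neighborhood rescaled_def by blast
    moreover have "x \<in> neighborhood d (skeleton P')" if "x \<in> skeleton L" for x
    proof -
      obtain z where z: "z \<in> skeleton P'" "x = h + s *\<^sub>R z"
        using \<open>x \<in> skeleton L\<close> unfolding L' rescaled_def by blast
      then have "dist z x < d" using close[of z] by (simp add: dist_commute)
      then show ?thesis using z unfolding mem_neighborhood by blast
    qed
    ultimately show ?thesis unfolding near_def by blast
  qed
  have denseL: "ball 0 R1 \<subseteq> neighborhood (c * r) (\<Union>L)"
  proof
    fix y :: 'a assume "y \<in> ball 0 R1"
    then obtain z where z: "z \<in> \<Union>P'" "dist z y < d"
      using P'(3) unfolding subset_iff mem_neighborhood by blast
    have "z \<in> tile_at p"
      using z(1) splits_subset[OF _ p(1)] unfolding p(3) leaves_def by blast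
    then have "z \<in> cball (pos p) (scale p * D)" using tile_at_subset_ball[OF p(1)] by auto
    then have "dist (h + s *\<^sub>R z) y < c * r"
      using move[of z] z d dist_triangle[of "h + s *\<^sub>R z" y z] by linarith
    moreover have "h + s *\<^sub>R z \<in> \<Union>L"
      using z(1) unfolding L rescaled_Union by (auto simp: rescaled_def)
    ultimately show "y \<in> neighborhood (c * r) (\<Union>L)" unfolding mem_neighborhood by blast
  qed
  have "skeleton E \<inter> ball 0 (R + 3 * d) \<subseteq> skeleton L"
    by (rule skeleton_dense_subpatch[OF fatE LE]) (use denseL in \<open>simp add: R1_def\<close>)
  then have near2: "near (R + 3 * d) d (skeleton P') (skeleton E)"
    using near1[of "R + 3 * d"] skeleton_mono[OF LE]
    unfolding near_def subset_iff mem_neighborhood Int_iff by meson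
  have near3: "near (R + 3 * d) d (skeleton E) (skeleton (translate v \<T>))"
    using near_translate[OF near_sym[OF P(2)] v]
    by (simp add: E_def translate_eq_rescaled skeleton_rescaled)
  have "near (R + 2 * d) (d + d) (skeleton \<T>') (skeleton E)"
    by (rule near_trans[OF near_mono[OF P'(2)] near_mono[OF near2]]) (use d bounds in \<open>auto simp: R1_def\<close>)
  then have "near R ((d + d) + d) (skeleton \<T>') (skeleton (translate v \<T>))"
    by (rule near_trans[OF near_mono near_mono[OF near3]]) (use d in auto)
  then have "near R e (skeleton \<T>') (skeleton (translate v \<T>))"
    by (rule near_mono) (use d in auto)
  then show ?thesis by blast
qed

end

text \<open>The ratio of a tile in a rule is recovered from the tile as the root of its volume; so there are
  only finitely many ratios.\<close>

lemma bounded_scheme_exists: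
  fixes \<sigma> :: "'a::euclidean_space scheme"
  assumes scheme: "multiscale_scheme \<sigma>" and norm: "normalized \<sigma>" and pos: "positioned \<sigma>"
  shows "\<exists>a c r D. bounded_scheme \<sigma> a c r D"
proof -
  let ?n = "length (prototiles \<sigma>)"
  let ?T = "\<lambda>j. prototiles \<sigma> ! j"
  define F where "F = (\<Union>j<?n. rule \<sigma> (?T j))"
  have "finite F" using scheme by (auto simp: F_def multiscale_scheme_def)
  define f where "f = (\<lambda>V::'a set. root DIM('a) (measure lebesgue V))"
  have f: "f (rescaled \<beta> y (?T k)) = \<beta>" if "0 < \<beta>" "k < ?n" for \<beta> y k
  proof -
    have "measure lebesgue (rescaled \<beta> y (?T k)) = \<beta> ^ DIM('a)"
      using that norm by (simp add: measure_rescaled normalized_def)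
    then show ?thesis using that by (simp add: f_def real_root_power_cancel)
  qed
  have f01: "0 < f V \<and> f V < 1" if V: "V \<in> F" for V
  proof -
    obtain k \<beta> where "\<beta> < 1" "tile_of_type \<sigma> k \<beta> V"
      using V scheme unfolding F_def multiscale_scheme_def by (metis UN_E lessThan_iff nth_mem)
    then show ?thesis using f by (auto simp: tile_of_type_def)
  qed
  define c where "c = Min (insert (1 / 2) (f ` F))"
  define a where "a = Max (insert (1 / 2) (f ` F))"
  have fin: "finite (insert (1 / 2) (f ` F))" using \<open>finite F\<close> by simp
  have "0 < c" unfolding c_def using fin f01 by (subst Min_gr_iff) auto
  have "a < 1" unfolding a_def using fin f01 by (subst Max_less_iff) auto
  have "c \<le> 1 / 2" unfolding c_def using fin by (intro Min_le) auto
  moreover have "1 / 2 \<le> a" unfolding a_def using fin by (intro Max_ge) auto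
  ultimately have "c \<le> a" by simp
  have ca: "c \<le> f V" "f V \<le> a" if "V \<in> F" for V
    unfolding c_def a_def using fin that by (auto intro: Min_le Max_ge)
  have "\<exists>r>0. ball 0 r \<subseteq> ?T j" if "j < ?n" for j
    using pos that unfolding positioned_def by (metis mem_interior nth_mem)
  then obtain \<rho> where \<rho>: "\<And>j. j < ?n \<Longrightarrow> 0 < \<rho> j" "\<And>j. j < ?n \<Longrightarrow> ball 0 (\<rho> j) \<subseteq> ?T j"
    by metis
  define r where "r = Min (insert 1 (\<rho> ` {..<?n}))"
  have "0 < r" unfolding r_def using \<rho>(1) by (subst Min_gr_iff) auto
  have r: "ball 0 r \<subseteq> ?T j" if "j < ?n" for j
  proof -
    have "r \<le> \<rho> j" unfolding r_def using that by (intro Min_le) auto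
    then show ?thesis using \<rho>(2)[OF that] by (meson order.trans subset_ball)
  qed
  have "bounded (\<Union>j<?n. ?T j)"
    using scheme by (intro bounded_UN) (auto simp: multiscale_scheme_def tile_def)
  then obtain D where D: "0 < D" "(\<Union>j<?n. ?T j) \<subseteq> ball 0 D"
    by (rule bounded_subset_ballD[where x = 0, elim_format]) blast
  have "bounded_scheme \<sigma> a c r D"
  proof
    fix j k \<beta> y
    assume "j < ?n" "k < ?n" "0 < \<beta>" "rescaled \<beta> y (?T k) \<in> rule \<sigma> (?T j)"
    then show "c \<le> \<beta> \<and> \<beta> \<le> a" using ca[of "rescaled \<beta> y (?T k)"] f by (auto simp: F_def)
  next
    fix j assume "j < ?n"
    then show "?T j \<subseteq> ball 0 D" using D by blast
  qed (fact scheme norm \<open>0 < c\<close> \<open>c \<le> a\<close> \<open>a < 1\<close> \<open>0 < r\<close> D(1) r)+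
  then show ?thesis by blast
qed

theorem theorem6p1:
  fixes \<sigma> :: "'a::euclidean_space scheme"
  assumes "multiscale_scheme \<sigma>" and "normalized \<sigma>" and "positioned \<sigma>"
    and "irreducible_scheme \<sigma>" and "incommensurable \<sigma>"
  shows "minimal_action (tiling_topology \<sigma>) translate"
proof -
  obtain a c r D where "bounded_scheme \<sigma> a c r D"
    using bounded_scheme_exists assms by blast
  then interpret bounded_scheme \<sigma> a c r D .
  interpret M: Metric_space "{A::'a set. closed A}" set_dist by (rule Metric_space_set_dist)
  show ?thesis
    unfolding minimal_action_def
  proof (intro ballI subset_antisym closure_of_subset_topspace subsetI)
    fix \<T> \<T>' assume "\<T> \<in> topspace (tiling_topology \<sigma>)" and T': "\<T>' \<in> topspace (tiling_topology \<sigma>)"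
    then have T: "\<T> \<in> tiling_space \<sigma>" "\<T>' \<in> tiling_space \<sigma>" by (simp_all add: topspace_tiling_topology)
    show "\<T>' \<in> tiling_topology \<sigma> closure_of range (\<lambda>g. translate g \<T>)"
      unfolding in_closure_of
    proof (intro conjI allI impI T')
      fix U assume U: "\<T>' \<in> U \<and> openin (tiling_topology \<sigma>) U"
      then obtain V where V: "openin M.mtopology V" "U = skeleton -` V \<inter> tiling_space \<sigma>"
        by (auto simp: tiling_topology_def openin_pullback_topology)
      then obtain \<rho> where \<rho>: "0 < \<rho>" "M.mball (skeleton \<T>') \<rho> \<subseteq> V"
        using U by (auto simp: M.openin_mtopology)
      define e where "e = min 1 \<rho>"
      have e: "0 < e / 2" "e / 2 < e" "e \<le> 1" "e \<le> \<rho>" using \<rho> by (auto simp: e_def)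
      obtain v where v: "near (1 / (e / 2)) (e / 2) (skeleton \<T>') (skeleton (translate v \<T>))"
        using skeleton_near_translate[OF assms(4,5) T(1) T(2), of "1 / (e / 2)" "e / 2"] e by auto
      then have "set_dist (skeleton \<T>') (skeleton (translate v \<T>)) < e"
        using set_dist_less_iff[OF e(3)] e unfolding close_at_eq_near[symmetric] by blast
      then have "skeleton (translate v \<T>) \<in> V"
        using \<rho>(2) e by (auto simp: skeleton_def M.in_mball)
      then have "translate v \<T> \<in> U" using V T translate_in_tiling_space by blast
      then show "\<exists>y. y \<in> range (\<lambda>g. translate g \<T>) \<and> y \<in> U" by blast
    qed
  qed
qed

end
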